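(* Let $F(x,y)=u\,\psi(r,s)$ be a spherically symmetric Finsler metric on an open subset $\mathcal{U}$ of $\mathbb{R}^n$, where $r=|x|$, $u=|y|$, $v=\langle x,y\rangle$, $s=v/u$. Then $F$ is both projectively flat and dually flat on $\mathcal{U}$ if and only if there is a constant $k_1$, independent of $y$, such that $$\frac1r\psi_r=k_1\,\psi\,\psi_s\qquad\text{and}\qquad \psi_s=k_1\left(\psi^2-s\,\psi\,\psi_s\right).$$
   Context: A Finsler metric on an open set $\mathcal{U}\subseteq\mathbb{R}^n$ is a function $F:\mathcal{U}\times\mathbb{R}^n\to[0,\infty)$, $(x,y)\mapsto F(x,y)$, smooth where $y\neq 0$, with $F(x,\lambda y)=\lambda F(x,y)$ for all $\lambda>0$, and such that $g_{ij}=\frac12\frac{\partial^2 F^2}{\partial y^i\partial y^j}$ is positive definite for all $y\neq0$. $F$ is spherically symmetric if it is invariant under all rotations of $\mathbb{R}^n$; such a metric has the form $F=|y|\,\psi\left(|x|,\frac{\langle x,y\rangle}{|y|}\right)$ with $\psi$ a positive smooth function ($|\cdot|$, $\langle\cdot,\cdot\rangle$ the standard Euclidean norm and inner product). Subscripts denote partial derivatives and repeated indices are summed. $F$ is projectively flat on $\mathcal{U}$ if all its geodesics are straight lines in $\mathcal{U}$; equivalently $F_{x^ky^l}y^k-F_{x^l}=0$ for all $l$. $F$ is dually flat on $\mathcal{U}$ if $L=F^2$ satisfies $L_{x^ky^l}y^k-2L_{x^l}=0$ for all $l$ (in the standard coordinates).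
   Formalization: The formal theorem assumes n ≥ 2 (for n = 1 the claim fails, e.g. ψ = 1 + s² − r²) and lets the constant k_1 depend on the connected component of U, since a single constant fails for disconnected U; for connected U it is one constant as stated. *)

theory Defs
  imports "HOL-Analysis.Analysis"
begin

text \<open>Intended for open \<open>S\<close> only.\<close>

primrec times_cont_diff_on ::
  "nat \<Rightarrow> ('a::real_normed_vector \<Rightarrow> 'b::real_normed_vector) \<Rightarrow> 'a set \<Rightarrow> bool" where
  "times_cont_diff_on 0 f S \<longleftrightarrow> continuous_on S f"
| "times_cont_diff_on (Suc k) f S \<longleftrightarrow>
     (\<forall>x\<in>S. f differentiable (at x)) \<and>
     (\<forall>v. times_cont_diff_on k (\<lambda>x. frechet_derivative f (at x) v) S)"

definition smooth_on :: "('a::real_normed_vector \<Rightarrow> 'b::real_normed_vector) \<Rightarrow> 'a set \<Rightarrow> bool" where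
  "smooth_on f S \<longleftrightarrow> (\<forall>k. times_cont_diff_on k f S)"

definition partial :: "(real^'n \<Rightarrow> real) \<Rightarrow> 'n \<Rightarrow> real^'n \<Rightarrow> real" where
  "partial f i p = deriv (\<lambda>t. f (p + t *\<^sub>R axis i 1)) 0"

definition dx :: "'n \<Rightarrow> (real^'n \<Rightarrow> real^'n \<Rightarrow> real) \<Rightarrow> real^'n \<Rightarrow> real^'n \<Rightarrow> real" where
  "dx i F x y = partial (\<lambda>z. F z y) i x"

definition dy :: "'n \<Rightarrow> (real^'n \<Rightarrow> real^'n \<Rightarrow> real) \<Rightarrow> real^'n \<Rightarrow> real^'n \<Rightarrow> real" where
  "dy i F x y = partial (\<lambda>w. F x w) i y"

definition sq :: "(real^'n \<Rightarrow> real^'n \<Rightarrow> real) \<Rightarrow> real^'n \<Rightarrow> real^'n \<Rightarrow> real" where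
  "sq F x y = (F x y)\<^sup>2"

definition fund_tensor :: "(real^'n \<Rightarrow> real^'n \<Rightarrow> real) \<Rightarrow> real^'n \<Rightarrow> real^'n \<Rightarrow> real^'n^'n" where
  "fund_tensor F x y = (\<chi> i j. 1 / 2 * dy j (dy i (sq F)) x y)"

definition finsler_metric_on :: "(real^'n) set \<Rightarrow> (real^'n \<Rightarrow> real^'n \<Rightarrow> real) \<Rightarrow> bool" where
  "finsler_metric_on U F \<longleftrightarrow>
     (\<forall>x\<in>U. \<forall>y. F x y \<ge> 0) \<and>
     smooth_on (\<lambda>(x, y). F x y) (U \<times> (- {0})) \<and>
     (\<forall>x\<in>U. \<forall>y. \<forall>c>0. F x (c *\<^sub>R y) = c * F x y) \<and>
     (\<forall>x\<in>U. \<forall>y. y \<noteq> 0 \<longrightarrow> (\<forall>v. v \<noteq> 0 \<longrightarrow> v \<bullet> (fund_tensor F x y *v v) > 0))"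

text \<open>\<open>U\<close> itself need not be rotation invariant.\<close>

definition spherically_symmetric_on :: "(real^'n) set \<Rightarrow> (real^'n \<Rightarrow> real^'n \<Rightarrow> real) \<Rightarrow> bool" where
  "spherically_symmetric_on U F \<longleftrightarrow>
     (\<forall>A. rotation_matrix A \<longrightarrow>
       (\<forall>x\<in>U. A *v x \<in> U \<longrightarrow> (\<forall>y. F (A *v x) (A *v y) = F x y)))"

text \<open>The spray coefficients
  \<open>G\<^sup>i = 1/4 g\<^sup>i\<^sup>l ((F\<^sup>2)\<^bsub>x\<^sup>k y\<^sup>l\<^esub> y\<^sup>k - (F\<^sup>2)\<^bsub>x\<^sup>l\<^esub>)\<close>; the equation \<open>c'' + 2 G(c, c') = 0\<close> below is the
  Euler--Lagrange equation of the energy, so a geodesic is parametrised with constant speed.\<close>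

definition spray :: "(real^'n \<Rightarrow> real^'n \<Rightarrow> real) \<Rightarrow> real^'n \<Rightarrow> real^'n \<Rightarrow> real^'n" where
  "spray F x y = (1 / 4) *\<^sub>R (matrix_inv (fund_tensor F x y) *v
     (\<chi> l. (\<Sum>k\<in>UNIV. dy l (dx k (sq F)) x y * y $ k) - dx l (sq F) x y))"

definition geodesic_on ::
  "(real^'n) set \<Rightarrow> (real^'n \<Rightarrow> real^'n \<Rightarrow> real) \<Rightarrow> real set \<Rightarrow> (real \<Rightarrow> real^'n) \<Rightarrow> bool" where
  "geodesic_on U F I c \<longleftrightarrow> (\<exists>c' c''. \<forall>t\<in>I.
     (c has_vector_derivative c' t) (at t) \<and>
     (c' has_vector_derivative c'' t) (at t) \<and>
     c t \<in> U \<and> c' t \<noteq> 0 \<and>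
     c'' t + 2 *\<^sub>R spray F (c t) (c' t) = 0)"

definition projectively_flat_on :: "(real^'n) set \<Rightarrow> (real^'n \<Rightarrow> real^'n \<Rightarrow> real) \<Rightarrow> bool" where
  "projectively_flat_on U F \<longleftrightarrow>
     (\<forall>I c. open I \<and> is_interval I \<and> geodesic_on U F I c \<longrightarrow> collinear (c ` I))"

definition dually_flat_on :: "(real^'n) set \<Rightarrow> (real^'n \<Rightarrow> real^'n \<Rightarrow> real) \<Rightarrow> bool" where
  "dually_flat_on U F \<longleftrightarrow>
     (\<forall>x\<in>U. \<forall>y. y \<noteq> 0 \<longrightarrow>
       (\<forall>l. (\<Sum>k\<in>UNIV. dy l (dx k (sq F)) x y * y $ k) - 2 * dx l (sq F) x y = 0))"

text \<open>The values \<open>(r, s) = (|x|, \<langle>x,y\<rangle>/|y|)\<close>. This set is not open (\<open>\<bar>s\<bar> \<le> r\<close>), so smoothness of a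
  profile on it means that the profile is smooth on an open neighbourhood.\<close>

definition rs_domain :: "(real^'n) set \<Rightarrow> (real \<times> real) set" where
  "rs_domain U = {(norm x, (x \<bullet> y) / norm y) | x y. x \<in> U \<and> y \<noteq> 0}"

definition positive_smooth_profile :: "(real \<times> real) set \<Rightarrow> (real \<Rightarrow> real \<Rightarrow> real) \<Rightarrow> bool" where
  "positive_smooth_profile D \<psi> \<longleftrightarrow>
     (\<forall>(r, s)\<in>D. \<psi> r s > 0) \<and>
     (\<exists>W. open W \<and> D \<subseteq> W \<and> smooth_on (\<lambda>(r, s). \<psi> r s) W)"

text \<open>At the origin (\<open>r = 0\<close>) the factor \<open>1/r\<close> is undefined, so the first equation is imposed only
  for \<open>r > 0\<close>.\<close>

definition profile_equations :: "real \<Rightarrow> (real \<Rightarrow> real \<Rightarrow> real) \<Rightarrow> real \<Rightarrow> real \<Rightarrow> bool" where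
  "profile_equations k \<psi> r s \<longleftrightarrow>
     (let \<psi>\<^sub>r = deriv (\<lambda>\<rho>. \<psi> \<rho> s) r; \<psi>\<^sub>s = deriv (\<lambda>\<sigma>. \<psi> r \<sigma>) s in
       (r > 0 \<longrightarrow> 1 / r * \<psi>\<^sub>r = k * \<psi> r s * \<psi>\<^sub>s) \<and>
       \<psi>\<^sub>s = k * ((\<psi> r s)\<^sup>2 - s * \<psi> r s * \<psi>\<^sub>s))"

end

theory Submission
  imports Defs
begin

text \<open>
Both flatness conditions are linked by a single first-order equation. Write \<open>X a\<close> for the derivative
of \<open>F\<close> in the base direction \<open>a\<close> and \<open>Y b\<close> for the derivative in the fibre direction \<open>b\<close>. A Finsler
metric in dimension at least two is projectively and dually flat on a connected open set iff
\<open>X a = k F (Y a)\<close> for all \<open>a\<close>, with a constant \<open>k\<close> (\<open>flat_iff_transport_eq\<close>).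

Suppose the transport equation \<open>X a = k F (Y a)\<close> holds. Differentiating it in a fibre direction and using
Euler's relation \<open>Y y = F\<close> yields the dual flatness equations. They identify the Euler--Lagrange covector
with \<open>2 k F\<close> times \<open>g y\<close>, where \<open>g\<close> is the fundamental tensor, so the spray is \<open>(k F / 2) y\<close>. A geodesic
thus has acceleration parallel to its velocity; its unit tangent is constant and it is straight.

Conversely let \<open>F\<close> be projectively and dually flat. Projective flatness speaks of geodesics, so one
through each \<open>(x, y)\<close> is needed: the spray is continuously differentiable by Cramer's rule, hence locally
Lipschitz, and the contraction principle applies (\<open>picard_lindelof\<close>). Straightness of that geodesic makes
the spray at \<open>(x, y)\<close> a multiple of \<open>y\<close>. The dual flatness equations then give \<open>X a = \<kappa> F (Y a)\<close>
with \<open>\<kappa> = X y / F\<^sup>2\<close>. It remains to see that \<open>\<kappa>\<close> is locally constant. Comparing the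
fibre derivative of this equation with dual flatness shows that \<open>\<kappa>\<close> does not depend on \<open>y\<close>. Symmetry of
the second base derivatives shows that \<open>d\<kappa>(c) (Y a) = d\<kappa>(a) (Y c)\<close>. As the dimension is at least two, there
is a nonzero \<open>y\<close> with \<open>d\<kappa>(y) = 0\<close>; taking \<open>a = y\<close> there leaves \<open>d\<kappa>(c) F = 0\<close>.

Finally, for \<open>F = |y| \<psi>(|x|, s)\<close> and \<open>x \<noteq> 0\<close> the defect \<open>X a - k F (Y a)\<close> is the inner product of \<open>a\<close>
with a combination of \<open>x\<close> and \<open>y\<close> whose coefficients are, up to nonzero factors, the defects of the two
profile equations (\<open>transport_defect\<close>). Where \<open>x\<close> and \<open>y\<close> are independent both coefficients vanish iff
the combination does; the remaining points, \<open>|s| = r\<close> and the origin, follow by continuity.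
\<close>

section \<open>Directional derivatives\<close>

definition dir_deriv ::
  "('a::real_normed_vector \<Rightarrow> 'b::real_normed_vector) \<Rightarrow> 'a \<Rightarrow> 'a \<Rightarrow> 'b" where
  "dir_deriv f v z = frechet_derivative f (at z) v"

lemma has_derivative_dir_deriv:
  "f differentiable (at z) \<Longrightarrow> (f has_derivative (\<lambda>v. dir_deriv f v z)) (at z)"
  unfolding dir_deriv_def frechet_derivative_works[symmetric] .

lemma dir_deriv_eqI: "(f has_derivative f') (at z) \<Longrightarrow> dir_deriv f v z = f' v"
  unfolding dir_deriv_def using frechet_derivative_at by metis

lemma bounded_linear_dir_deriv:
  "f differentiable (at z) \<Longrightarrow> bounded_linear (\<lambda>v. dir_deriv f v z)"
  using has_derivative_dir_deriv has_derivative_bounded_linear by blast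

lemma has_vector_derivative_along_line:
  assumes "f differentiable (at (z + t *\<^sub>R v))"
  shows "((\<lambda>t. f (z + t *\<^sub>R v)) has_vector_derivative dir_deriv f v (z + t *\<^sub>R v)) (at t)"
proof -
  have "((\<lambda>t. z + t *\<^sub>R v) has_derivative (\<lambda>h. h *\<^sub>R v)) (at t)"
    by (auto intro!: derivative_eq_intros)
  from has_derivative_compose[OF this has_derivative_dir_deriv[OF assms]]
  show ?thesis
    by (simp add: has_vector_derivative_def
        linear_cmul[OF bounded_linear.linear[OF bounded_linear_dir_deriv[OF assms]]])
qed

lemma has_real_derivative_along_line:
  fixes f :: "'a::real_normed_vector \<Rightarrow> real"
  assumes "f differentiable (at (z + t *\<^sub>R v))"
  shows "((\<lambda>t. f (z + t *\<^sub>R v)) has_real_derivative dir_deriv f v (z + t *\<^sub>R v)) (at t)"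
  using has_vector_derivative_along_line[OF assms] by (simp add: has_real_derivative_iff_has_vector_derivative)

lemma dir_deriv_cong_open:
  assumes "open S" "z \<in> S" "\<And>x. x \<in> S \<Longrightarrow> f x = g x" "f differentiable (at z)"
  shows "g differentiable (at z)" and "dir_deriv g v z = dir_deriv f v z"
proof -
  have "(g has_derivative (\<lambda>v. dir_deriv f v z)) (at z)"
    using has_derivative_transform_within_open[OF has_derivative_dir_deriv[OF assms(4)] assms(1,2)] assms(3)
    by blast
  then show "g differentiable (at z)" "dir_deriv g v z = dir_deriv f v z"
    by (auto simp: differentiable_def dir_deriv_eqI)
qed

lemma dir_deriv_mult:
  fixes f g :: "'a::real_normed_vector \<Rightarrow> real"
  assumes "f differentiable (at z)" "g differentiable (at z)"
  shows "dir_deriv (\<lambda>x. f x * g x) v z = f z * dir_deriv g v z + dir_deriv f v z * g z"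
  using dir_deriv_eqI[OF has_derivative_mult[OF has_derivative_dir_deriv[OF assms(1)]
        has_derivative_dir_deriv[OF assms(2)]]] .

lemma dir_deriv_add_right:
  "f differentiable (at z) \<Longrightarrow> dir_deriv f (v + w) z = dir_deriv f v z + dir_deriv f w z"
  by (rule linear_add[OF bounded_linear.linear[OF bounded_linear_dir_deriv]])

lemma dir_deriv_scaleR_right:
  "f differentiable (at z) \<Longrightarrow> dir_deriv f (c *\<^sub>R v) z = c *\<^sub>R dir_deriv f v z"
  by (rule linear_cmul[OF bounded_linear.linear[OF bounded_linear_dir_deriv]])

section \<open>Symmetry of second derivatives\<close>

text \<open>
The mean value theorem applied twice, first along \<open>v\<close> and then along \<open>w\<close>. The left-hand side is
symmetric in \<open>v\<close> and \<open>w\<close>; this is what makes mixed derivatives agree.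
\<close>

lemma second_difference_mean_value:
  fixes f :: "'a::real_normed_vector \<Rightarrow> real"
  assumes diff: "\<And>x. x \<in> S \<Longrightarrow> f differentiable (at x)"
    and diff2: "\<And>x. x \<in> S \<Longrightarrow> dir_deriv f v differentiable (at x)"
    and box: "\<And>s t. 0 \<le> s \<Longrightarrow> s \<le> h \<Longrightarrow> 0 \<le> t \<Longrightarrow> t \<le> h \<Longrightarrow> z + s *\<^sub>R v + t *\<^sub>R w \<in> S"
    and "h > 0"
  shows "\<exists>s t. 0 \<le> s \<and> s \<le> h \<and> 0 \<le> t \<and> t \<le> h \<and>
    f (z + h *\<^sub>R v + h *\<^sub>R w) - f (z + h *\<^sub>R v) - f (z + h *\<^sub>R w) + f z =
      h\<^sup>2 * dir_deriv (dir_deriv f v) w (z + s *\<^sub>R v + t *\<^sub>R w)"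
proof -
  define p where "p s = f ((z + h *\<^sub>R w) + s *\<^sub>R v) - f (z + s *\<^sub>R v)" for s
  have "(p has_real_derivative
      dir_deriv f v ((z + h *\<^sub>R w) + s *\<^sub>R v) - dir_deriv f v (z + s *\<^sub>R v)) (at s)"
    if "0 \<le> s" "s \<le> h" for s
    unfolding p_def using box[of s h] box[of s 0] that \<open>h > 0\<close>
    by (intro derivative_intros has_real_derivative_along_line diff) (auto simp: algebra_simps)
  then obtain s where s: "0 < s" "s < h"
    "p h - p 0 = h * (dir_deriv f v ((z + h *\<^sub>R w) + s *\<^sub>R v) - dir_deriv f v (z + s *\<^sub>R v))"
    using MVT2[of 0 h p "\<lambda>s. dir_deriv f v ((z + h *\<^sub>R w) + s *\<^sub>R v) - dir_deriv f v (z + s *\<^sub>R v)"]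
      \<open>h > 0\<close> by auto
  have "((\<lambda>t. dir_deriv f v ((z + s *\<^sub>R v) + t *\<^sub>R w)) has_real_derivative
      dir_deriv (dir_deriv f v) w ((z + s *\<^sub>R v) + t *\<^sub>R w)) (at t)"
    if "0 \<le> t" "t \<le> h" for t
    using box[of s t] s that by (intro has_real_derivative_along_line diff2) auto
  then obtain t where t: "0 < t" "t < h"
    "dir_deriv f v ((z + s *\<^sub>R v) + h *\<^sub>R w) - dir_deriv f v ((z + s *\<^sub>R v) + 0 *\<^sub>R w)
      = h * dir_deriv (dir_deriv f v) w ((z + s *\<^sub>R v) + t *\<^sub>R w)"
    using MVT2[of 0 h "\<lambda>t. dir_deriv f v ((z + s *\<^sub>R v) + t *\<^sub>R w)"
        "\<lambda>t. dir_deriv (dir_deriv f v) w ((z + s *\<^sub>R v) + t *\<^sub>R w)"] \<open>h > 0\<close>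
    by auto
  have "f (z + h *\<^sub>R v + h *\<^sub>R w) - f (z + h *\<^sub>R v) - f (z + h *\<^sub>R w) + f z = p h - p 0"
    by (simp add: p_def algebra_simps)
  also have "\<dots> = h\<^sup>2 * dir_deriv (dir_deriv f v) w (z + s *\<^sub>R v + t *\<^sub>R w)"
    using s(3) t(3) by (simp add: power2_eq_square algebra_simps)
  finally show ?thesis
    using s t by (intro exI[of _ s] exI[of _ t]) auto
qed

text \<open>
The same second difference, divided by \<open>h\<^sup>2\<close>, is a value of either mixed derivative at a point that tends
to \<open>z\<close>, so by continuity both have the same value at \<open>z\<close>.
\<close>

lemma dir_deriv_commute:
  fixes f :: "'a::real_normed_vector \<Rightarrow> real"
  assumes "open S" "z \<in> S"
    and diff: "\<And>x. x \<in> S \<Longrightarrow> f differentiable (at x)"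
    and diff2: "\<And>x u. x \<in> S \<Longrightarrow> dir_deriv f u differentiable (at x)"
    and cont: "\<And>u u'. continuous_on S (dir_deriv (dir_deriv f u) u')"
  shows "dir_deriv (dir_deriv f v) w z = dir_deriv (dir_deriv f w) v z"
proof -
  obtain e where e: "e > 0" "ball z e \<subseteq> S"
    using assms(1,2) open_contains_ball by blast
  (* The side of a parallelogram at z spanned by v and w that fits into the ball; the summand 1
     keeps the denominator positive when v = w = 0. *)
  define d where "d = e / (norm v + norm w + 1)"
  have nn: "norm v + norm w + 1 > 0" by (simp add: add_nonneg_pos)
  have d: "d > 0" using e nn by (simp add: d_def)
  have box: "z + s *\<^sub>R v + t *\<^sub>R w \<in> S" if "0 \<le> s" "s \<le> d" "0 \<le> t" "t \<le> d" for s t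
  proof -
    have "norm (s *\<^sub>R v + t *\<^sub>R w) \<le> s * norm v + t * norm w"
      using norm_triangle_ineq[of "s *\<^sub>R v" "t *\<^sub>R w"] that by simp
    also have "\<dots> \<le> d * norm v + d * norm w"
      by (intro add_mono mult_right_mono) (use that in auto)
    also have "\<dots> < d * (norm v + norm w + 1)"
      using d by (simp add: algebra_simps)
    also have "\<dots> = e"
      using nn by (simp add: d_def)
    finally have "z + (s *\<^sub>R v + t *\<^sub>R w) \<in> ball z e"
      by (metis add_diff_cancel_left' dist_commute dist_norm mem_ball)
    then show ?thesis using e by (auto simp: add.assoc)
  qed
  define h where "h n = d / Suc n" for n :: nat
  have h: "0 < h n" "h n \<le> d" for n
    using d by (auto simp: h_def field_simps)
  have h0: "h \<longlonglongrightarrow> 0"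
    unfolding h_def by (rule lim_const_over_n[THEN filterlim_sequentially_Suc[THEN iffD2]])
  have lim: "(\<lambda>n. dir_deriv (dir_deriv f v') w' (z + s n *\<^sub>R v' + t n *\<^sub>R w'))
      \<longlonglongrightarrow> dir_deriv (dir_deriv f v') w' z"
    if "\<And>n. 0 \<le> s n \<and> s n \<le> h n \<and> 0 \<le> t n \<and> t n \<le> h n" for s t v' w'
  proof -
    have "s \<longlonglongrightarrow> 0" "t \<longlonglongrightarrow> 0"
      using that by (auto intro!: tendsto_sandwich[OF _ _ tendsto_const h0])
    then have "(\<lambda>n. z + s n *\<^sub>R v' + t n *\<^sub>R w') \<longlonglongrightarrow> z + 0 *\<^sub>R v' + 0 *\<^sub>R w'"
      by (intro tendsto_intros)
    moreover have "isCont (dir_deriv (dir_deriv f v') w') z"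
      using cont assms(1,2) by (simp add: continuous_on_eq_continuous_at)
    ultimately show ?thesis
      using isCont_tendsto_compose by force
  qed
  define \<Delta> where "\<Delta> n = f (z + h n *\<^sub>R v + h n *\<^sub>R w) - f (z + h n *\<^sub>R v) - f (z + h n *\<^sub>R w) + f z" for n
  have "\<exists>s t. 0 \<le> s \<and> s \<le> h n \<and> 0 \<le> t \<and> t \<le> h n \<and>
      \<Delta> n = (h n)\<^sup>2 * dir_deriv (dir_deriv f v) w (z + s *\<^sub>R v + t *\<^sub>R w)" for n
    unfolding \<Delta>_def
  proof (rule second_difference_mean_value[where S = S])
    fix s t assume "0 \<le> s" "s \<le> h n" "0 \<le> t" "t \<le> h n"
    then show "z + s *\<^sub>R v + t *\<^sub>R w \<in> S" using box[of s t] h[of n] by auto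
  qed (use diff diff2 h in auto)
  then obtain s t where st: "\<And>n. 0 \<le> s n \<and> s n \<le> h n \<and> 0 \<le> t n \<and> t n \<le> h n"
    "\<And>n. \<Delta> n = (h n)\<^sup>2 * dir_deriv (dir_deriv f v) w (z + s n *\<^sub>R v + t n *\<^sub>R w)"
    by metis
  have \<Delta>2: "\<Delta> n = f (z + h n *\<^sub>R w + h n *\<^sub>R v) - f (z + h n *\<^sub>R w) - f (z + h n *\<^sub>R v) + f z" for n
    by (simp add: \<Delta>_def algebra_simps)
  have "\<exists>s t. 0 \<le> s \<and> s \<le> h n \<and> 0 \<le> t \<and> t \<le> h n \<and>
      \<Delta> n = (h n)\<^sup>2 * dir_deriv (dir_deriv f w) v (z + s *\<^sub>R w + t *\<^sub>R v)" for n
    unfolding \<Delta>2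
  proof (rule second_difference_mean_value[where S = S])
    fix s t assume "0 \<le> s" "s \<le> h n" "0 \<le> t" "t \<le> h n"
    then show "z + s *\<^sub>R w + t *\<^sub>R v \<in> S" using box[of t s] h[of n] by (auto simp: algebra_simps)
  qed (use diff diff2 h in auto)
  then obtain s' t' where st': "\<And>n. 0 \<le> s' n \<and> s' n \<le> h n \<and> 0 \<le> t' n \<and> t' n \<le> h n"
    "\<And>n. \<Delta> n = (h n)\<^sup>2 * dir_deriv (dir_deriv f w) v (z + s' n *\<^sub>R w + t' n *\<^sub>R v)"
    by metis
  have "dir_deriv (dir_deriv f v) w (z + s n *\<^sub>R v + t n *\<^sub>R w)
      = dir_deriv (dir_deriv f w) v (z + s' n *\<^sub>R w + t' n *\<^sub>R v)" for n
    using st(2)[of n] st'(2)[of n] h(1)[of n] by simp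
  then show ?thesis
    using lim[OF st(1), of v w] lim[OF st'(1), of w v] LIMSEQ_unique by auto
qed

section \<open>Closure properties of differentiability classes\<close>

text \<open>
Folding the recursive clause into \<^const>\<open>dir_deriv\<close> keeps the inductions below free of
\<^const>\<open>frechet_derivative\<close>; it replaces the defining clause as a rewrite rule.
\<close>

lemma times_cont_diff_on_Suc_iff:
  "times_cont_diff_on (Suc k) f S \<longleftrightarrow>
    (\<forall>x\<in>S. f differentiable (at x)) \<and> (\<forall>v. times_cont_diff_on k (dir_deriv f v) S)"
  by (simp add: dir_deriv_def[abs_def])

declare times_cont_diff_on.simps(2) [simp del]
declare times_cont_diff_on_Suc_iff [simp]

lemma times_cont_diff_on_cong_imp:
  assumes "open S" "\<And>x. x \<in> S \<Longrightarrow> f x = g x" "times_cont_diff_on k f S"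
  shows "times_cont_diff_on k g S"
  using assms(2,3)
proof (induction k arbitrary: f g)
  case 0
  then show ?case using continuous_on_cong by force
next
  case (Suc k)
  have "\<forall>x\<in>S. g differentiable (at x)"
    using Suc.prems dir_deriv_cong_open(1)[OF assms(1), of _ f g] by auto
  moreover have "times_cont_diff_on k (dir_deriv g v) S" for v
  proof (rule Suc.IH)
    show "dir_deriv f v x = dir_deriv g v x" if "x \<in> S" for x
      using Suc.prems dir_deriv_cong_open(2)[OF assms(1), of x f g] that by auto
    show "times_cont_diff_on k (dir_deriv f v) S" using Suc.prems by simp
  qed
  ultimately show ?case by simp
qed

lemma times_cont_diff_on_SucD: "times_cont_diff_on (Suc k) f S \<Longrightarrow> times_cont_diff_on k f S"
proof (induction k arbitrary: f)
  case 0
  then show ?case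
    by (auto intro!: continuous_at_imp_continuous_on differentiable_imp_continuous_within)
next
  case (Suc k)
  then show ?case by (subst times_cont_diff_on_Suc_iff) auto
qed

lemma times_cont_diff_on_add:
  assumes "open S" "times_cont_diff_on k f S" "times_cont_diff_on k g S"
  shows "times_cont_diff_on k (\<lambda>x. f x + g x) S"
  using assms(2,3)
proof (induction k arbitrary: f g)
  case 0
  then show ?case by (auto intro: continuous_intros)
next
  case (Suc k)
  have d: "((\<lambda>x. f x + g x) has_derivative (\<lambda>v. dir_deriv f v x + dir_deriv g v x)) (at x)"
    if "x \<in> S" for x
    using Suc.prems that by (intro has_derivative_add has_derivative_dir_deriv) auto
  have "times_cont_diff_on k (dir_deriv (\<lambda>x. f x + g x) v) S" for v
    by (rule times_cont_diff_on_cong_imp[OF assms(1) _ Suc.IH[of "dir_deriv f v" "dir_deriv g v"]])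
      (use Suc.prems in \<open>auto simp: dir_deriv_eqI[OF d]\<close>)
  then show ?case using d by (auto simp: differentiable_def)
qed

lemma times_cont_diff_on_mult:
  fixes f g :: "'a::real_normed_vector \<Rightarrow> real"
  assumes "open S" "times_cont_diff_on k f S" "times_cont_diff_on k g S"
  shows "times_cont_diff_on k (\<lambda>x. f x * g x) S"
  using assms(2,3)
proof (induction k arbitrary: f g)
  case 0
  then show ?case by (auto intro: continuous_intros)
next
  case (Suc k)
  have d: "((\<lambda>x. f x * g x) has_derivative (\<lambda>v. f x * dir_deriv g v x + dir_deriv f v x * g x)) (at x)"
    if "x \<in> S" for x
    using Suc.prems that by (intro has_derivative_mult has_derivative_dir_deriv) auto
  have "times_cont_diff_on k (dir_deriv (\<lambda>x. f x * g x) v) S" for v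
    by (rule times_cont_diff_on_cong_imp[OF assms(1) _ times_cont_diff_on_add[OF assms(1)
          Suc.IH[of f "dir_deriv g v"] Suc.IH[of "dir_deriv f v" g]]])
      (use Suc.prems times_cont_diff_on_SucD[OF Suc.prems(1)]
        times_cont_diff_on_SucD[OF Suc.prems(2)] in \<open>auto simp: dir_deriv_eqI[OF d]\<close>)
  then show ?case using d by (auto simp: differentiable_def)
qed

lemma dir_deriv_const [simp]: "dir_deriv (\<lambda>_. c) v = (\<lambda>_. 0)"
  by (auto simp: dir_deriv_eqI[OF has_derivative_const] fun_eq_iff)

lemma times_cont_diff_on_const: "times_cont_diff_on k (\<lambda>_. c) S"
  by (induction k arbitrary: c) auto

lemma times_cont_diff_on_bounded_linear:
  assumes "bounded_linear f"
  shows "times_cont_diff_on k f S"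
proof -
  have "dir_deriv f v x = f v" for v x
    using bounded_linear_imp_has_derivative[OF assms] dir_deriv_eqI by blast
  then have "dir_deriv f v = (\<lambda>_. f v)" for v by auto
  then show ?thesis
    using assms times_cont_diff_on_const[of _ _ S] linear_continuous_on
      bounded_linear_imp_differentiable
    by (cases k) auto
qed

lemma times_cont_diff_on_inverse:
  fixes f :: "'a::real_normed_vector \<Rightarrow> real"
  assumes "open S" "times_cont_diff_on k f S" "\<And>x. x \<in> S \<Longrightarrow> f x \<noteq> 0"
  shows "times_cont_diff_on k (\<lambda>x. inverse (f x)) S"
  using assms(2)
proof (induction k)
  case 0
  then show ?case using assms(3) by (auto intro: continuous_intros)
next
  case (Suc k)
  have d: "((\<lambda>x. inverse (f x)) has_derivative
      (\<lambda>v. (- 1 * dir_deriv f v x) * (inverse (f x) * inverse (f x)))) (at x)"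
    if "x \<in> S" for x
    using Suc.prems that assms(3)[OF that]
    by (auto intro!: derivative_eq_intros has_derivative_dir_deriv)
  have i: "times_cont_diff_on k (\<lambda>x. inverse (f x)) S"
    using Suc times_cont_diff_on_SucD by blast
  have "times_cont_diff_on k (dir_deriv (\<lambda>x. inverse (f x)) v) S" for v
    by (rule times_cont_diff_on_cong_imp[OF assms(1) _ times_cont_diff_on_mult[OF assms(1)
          times_cont_diff_on_mult[OF assms(1) times_cont_diff_on_const[of _ "-1"], of _ "dir_deriv f v"]
          times_cont_diff_on_mult[OF assms(1) i i]]])
      (use Suc.prems in \<open>auto simp: dir_deriv_eqI[OF d]\<close>)
  then show ?case using d by (auto simp: differentiable_def)
qed

lemma times_cont_diff_on_sum:
  assumes "open S" "\<And>i. i \<in> I \<Longrightarrow> times_cont_diff_on k (f i) S"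
  shows "times_cont_diff_on k (\<lambda>x. \<Sum>i\<in>I. f i x) S"
  using assms(2)
  by (induction I rule: infinite_finite_induct)
    (auto intro!: times_cont_diff_on_const times_cont_diff_on_add[OF assms(1)])

lemma times_cont_diff_on_prod:
  fixes f :: "'i \<Rightarrow> 'a::real_normed_vector \<Rightarrow> real"
  assumes "open S" "\<And>i. i \<in> I \<Longrightarrow> times_cont_diff_on k (f i) S"
  shows "times_cont_diff_on k (\<lambda>x. \<Prod>i\<in>I. f i x) S"
  using assms(2)
  by (induction I rule: infinite_finite_induct)
    (auto intro!: times_cont_diff_on_const times_cont_diff_on_mult[OF assms(1)])

text \<open>
By the Leibniz formula the determinant is a polynomial in the entries. Together with Cramer's rule this
controls the regularity of the spray without any analysis of matrix inversion.
\<close>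

lemma times_cont_diff_on_det:
  fixes A :: "'a::real_normed_vector \<Rightarrow> real^'n^'n"
  assumes "open S" "\<And>i j. times_cont_diff_on k (\<lambda>x. A x $ i $ j) S"
  shows "times_cont_diff_on k (\<lambda>x. det (A x)) S"
  unfolding det_def
  by (intro times_cont_diff_on_sum times_cont_diff_on_mult times_cont_diff_on_prod
      times_cont_diff_on_const assms)

lemma smooth_on_dir_deriv: "smooth_on f S \<Longrightarrow> smooth_on (dir_deriv f v) S"
  unfolding smooth_on_def using times_cont_diff_on_Suc_iff by blast

lemma smooth_on_differentiable: "smooth_on f S \<Longrightarrow> x \<in> S \<Longrightarrow> f differentiable (at x)"
  unfolding smooth_on_def using times_cont_diff_on_Suc_iff by blast

lemma smooth_on_continuous_on: "smooth_on f S \<Longrightarrow> continuous_on S f"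
  unfolding smooth_on_def using times_cont_diff_on.simps(1) by blast

lemma smooth_on_mult:
  fixes f g :: "'a::real_normed_vector \<Rightarrow> real"
  shows "open S \<Longrightarrow> smooth_on f S \<Longrightarrow> smooth_on g S \<Longrightarrow> smooth_on (\<lambda>x. f x * g x) S"
  unfolding smooth_on_def using times_cont_diff_on_mult by blast

lemma smooth_on_dir_deriv_commute:
  fixes f :: "'a::real_normed_vector \<Rightarrow> real"
  assumes "open S" "smooth_on f S" "z \<in> S"
  shows "dir_deriv (dir_deriv f v) w z = dir_deriv (dir_deriv f w) v z"
  by (intro dir_deriv_commute[OF assms(1,3)])
    (auto intro: smooth_on_differentiable smooth_on_continuous_on smooth_on_dir_deriv assms(2))

text \<open>
The derivatives in the finitely many basis directions are bounded on the compact ball, which bounds the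
operator norm of the full derivative; convexity of the ball does the rest.
\<close>

lemma times_cont_diff_on_1_imp_lipschitz_on_cball:
  fixes p :: "'a::euclidean_space \<Rightarrow> real"
  assumes "times_cont_diff_on 1 p S" "cball z0 r \<subseteq> S"
  shows "\<exists>L. L-lipschitz_on (cball z0 r) p"
proof -
  have diff: "p differentiable (at z)" if "z \<in> cball z0 r" for z
    using assms that by (auto simp: numeral_eq_Suc One_nat_def simp del: mem_cball)
  have "\<exists>M\<ge>0. \<forall>z\<in>cball z0 r. norm (dir_deriv p b z) \<le> M" for b
  proof -
    have "continuous_on (cball z0 r) (dir_deriv p b)"
      using assms by (auto intro: continuous_on_subset)
    then have "bounded (dir_deriv p b ` cball z0 r)"
      by (intro compact_imp_bounded compact_continuous_image) auto
    then obtain M where "\<forall>z\<in>cball z0 r. norm (dir_deriv p b z) \<le> M"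
      by (auto simp: bounded_iff)
    then show ?thesis by (intro exI[of _ "max 0 M"]) auto
  qed
  then obtain M where M: "\<And>b. M b \<ge> 0" "\<And>b z. z \<in> cball z0 r \<Longrightarrow> norm (dir_deriv p b z) \<le> M b"
    by metis
  define L where "L = (\<Sum>b\<in>Basis. M b)"
  have L: "L \<ge> 0" unfolding L_def by (intro sum_nonneg M)
  have "norm (dir_deriv p v z) \<le> L * norm v" if "z \<in> cball z0 r" for v z
  proof -
    have lin: "linear (\<lambda>v. dir_deriv p v z)"
      using bounded_linear.linear[OF bounded_linear_dir_deriv[OF diff[OF that]]] .
    have "dir_deriv p v z = (\<Sum>b\<in>Basis. (v \<bullet> b) *\<^sub>R dir_deriv p b z)"
      using linear_sum[OF lin, of "\<lambda>b. (v \<bullet> b) *\<^sub>R b" Basis] linear_cmul[OF lin]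
      by (simp add: euclidean_representation)
    also have "norm \<dots> \<le> (\<Sum>b\<in>Basis. norm v * M b)"
      using M that by (intro sum_norm_le) (auto simp: abs_mult Basis_le_norm intro!: mult_mono)
    finally show ?thesis by (simp add: L_def sum_distrib_left mult.commute)
  qed
  then have on: "onorm (\<lambda>v. dir_deriv p v z) \<le> L" if "z \<in> cball z0 r" for z
    using that by (intro onorm_le) 
  define p' where "p' z v = dir_deriv p v z" for z v
  have "(p has_derivative p' z) (at z within cball z0 r)" "onorm (p' z) \<le> L"
    if "z \<in> cball z0 r" for z
    using has_derivative_at_withinI[OF has_derivative_dir_deriv[OF diff[OF that]]] on[OF that]
    by (simp_all add: p'_def[abs_def])
  then have "norm (p x - p y) \<le> L * norm (x - y)" if "x \<in> cball z0 r" "y \<in> cball z0 r" for x y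
    using that by (intro differentiable_bound[OF convex_cball])
  then show ?thesis using L
    by (intro exI[of _ L]) (auto simp: lipschitz_on_def dist_norm)
qed

section \<open>Local existence for autonomous differential equations\<close>

text \<open>
The Picard operator is a contraction on bounded continuous functions. To have it act on curves
\<open>\<real> \<rightarrow> 'a\<close> without restrictions, the vector field is composed with the nearest-point projection onto the
ball, which preserves the Lipschitz constant and makes it bounded, and time is clamped to \<open>[-h, h]\<close>.
Integrals start at \<open>-h\<close>, so that an oriented integral from \<open>0\<close> to \<open>t\<close> is a difference of two of them.
\<close>

lemma picard_lindelof:
  fixes V :: "'a::euclidean_space \<Rightarrow> 'a"
  assumes "r > 0" and lip: "L-lipschitz_on (cball z0 r) V"
  obtains h \<phi> where "h > 0" "\<phi> 0 = z0"
    "\<And>t. t \<in> {-h<..<h} \<Longrightarrow> \<phi> t \<in> cball z0 r \<and> (\<phi> has_vector_derivative V (\<phi> t)) (at t)"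
proof -
  define g where "g z = V (closest_point (cball z0 r) z)" for z
  have cp: "closest_point (cball z0 r) z \<in> cball z0 r" for z
    using \<open>r > 0\<close> by (intro closest_point_in_set) auto
  have L: "L \<ge> 0" using lip lipschitz_on_nonneg by blast
  have glip: "dist (g x) (g y) \<le> L * dist x y" for x y
  proof -
    have "dist (g x) (g y) \<le> L * dist (closest_point (cball z0 r) x) (closest_point (cball z0 r) y)"
      unfolding g_def using lip cp by (intro lipschitz_onD)
    also have "\<dots> \<le> L * dist x y"
      using \<open>r > 0\<close> L by (intro mult_left_mono closest_point_lipschitz) auto
    finally show ?thesis .
  qed
  have gcont: "continuous_on UNIV g"
    by (rule lipschitz_on_continuous_on[of L]) (auto simp: lipschitz_on_def glip L)
  have "compact (V ` cball z0 r)"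
    using lipschitz_on_continuous_on[OF lip] by (intro compact_continuous_image) auto
  then obtain M where "\<And>z. z \<in> cball z0 r \<Longrightarrow> norm (V z) \<le> M"
    by (meson compact_imp_bounded bounded_iff imageI)
  then have M: "norm (g z) \<le> M" for z
    using cp by (auto simp: g_def)
  have M0: "M \<ge> 0" using M[of z0] norm_ge_zero order_trans by blast
  (* Chosen so that 3 h L <= 1/2 (contraction) and 3 h M <= r (the solution stays in the ball);
     the factor 3 comes from the crude estimate of J below, and the summands 1 avoid division by 0. *)
  define h where "h = min (1 / (6 * (L + 1))) (r / (3 * (M + 1)))"
  have h: "h > 0" using L M0 \<open>r > 0\<close> by (auto simp: h_def)
  have hL: "3 * h * L \<le> 1 / 2"
  proof -
    have "3 * h * L \<le> 3 * h * (L + 1)" using h by (intro mult_left_mono) auto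
    also have "\<dots> \<le> 3 * (1 / (6 * (L + 1))) * (L + 1)"
      using L by (intro mult_right_mono mult_left_mono) (auto simp: h_def)
    also have "\<dots> = 1 / 2"
      using L by (simp add: divide_simps)
    finally show ?thesis .
  qed
  have hM: "3 * h * M \<le> r"
  proof -
    have "3 * h * M \<le> 3 * h * (M + 1)" using h by (intro mult_left_mono) auto
    also have "\<dots> \<le> 3 * (r / (3 * (M + 1))) * (M + 1)"
      using M0 by (intro mult_right_mono mult_left_mono) (auto simp: h_def)
    also have "\<dots> = r"
      using M0 by (simp add: divide_simps)
    finally show ?thesis .
  qed
  define cl where "cl t = max (-h) (min h t)" for t :: real
  have cl: "cl t \<in> {-h..h}" for t using h by (auto simp: cl_def)
  have clcont: "continuous_on UNIV cl" unfolding cl_def by (intro continuous_intros)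
  define J where "J u t = integral {-h..cl t} u - integral {-h..0} u" for u :: "real \<Rightarrow> 'a" and t
  have int: "u integrable_on {-h..b}" if "continuous_on UNIV u" for b and u :: "real \<Rightarrow> 'a"
    using that by (intro integrable_continuous_real) (auto intro: continuous_on_subset)
  have Jbound: "norm (J u t) \<le> 3 * h * B" if u: "continuous_on UNIV u" "\<And>s. norm (u s) \<le> B" for u B t
  proof -
    have B: "B \<ge> 0" using u(2)[of 0] norm_ge_zero order_trans by blast
    have *: "norm (integral {-h..b} u) \<le> B * (b + h)" if "-h \<le> b" for b
      using integral_bound[of "-h" b u B] that u by (auto intro: continuous_on_subset)
    have "norm (J u t) \<le> norm (integral {-h..cl t} u) + norm (integral {-h..0} u)"
      unfolding J_def by (rule norm_triangle_ineq4)
    also have "\<dots> \<le> B * (cl t + h) + B * (0 + h)"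
      using cl[of t] h by (intro add_mono *) auto
    also have "\<dots> \<le> B * (h + h) + B * (0 + h)"
      using cl[of t] B by (intro add_mono mult_left_mono) auto
    finally show ?thesis by (simp add: algebra_simps)
  qed
  have Jcont: "continuous_on UNIV (J u)" if "continuous_on UNIV u" for u
  proof -
    have "continuous_on {-h..h} (\<lambda>x. integral {-h..x} u)"
      using int[OF that] by (rule indefinite_integral_continuous_1)
    then have "continuous_on UNIV (\<lambda>t. integral {-h..cl t} u)"
      using clcont by (rule continuous_on_compose2) (use cl in auto)
    then show ?thesis unfolding J_def by (intro continuous_intros)
  qed
  have gc: "continuous_on UNIV (\<lambda>s. g (apply_bcontfun \<phi> s))" for \<phi> :: "real \<Rightarrow>\<^sub>C 'a"
    by (rule continuous_on_compose2[OF gcont]) auto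
  define T where "T \<phi> = Bcontfun (\<lambda>t. z0 + J (\<lambda>s. g (apply_bcontfun \<phi> s)) t)" for \<phi> :: "real \<Rightarrow>\<^sub>C 'a"
  have T: "apply_bcontfun (T \<phi>) t = z0 + J (\<lambda>s. g (apply_bcontfun \<phi> s)) t" for \<phi> t
  proof -
    have "norm (z0 + J (\<lambda>s. g (apply_bcontfun \<phi> s)) t) \<le> norm z0 + 3 * h * M" for t
      using order_trans[OF norm_triangle_ineq add_left_mono[OF Jbound[OF gc M]]] .
    then have "(\<lambda>t. z0 + J (\<lambda>s. g (apply_bcontfun \<phi> s)) t) \<in> bcontfun"
      using Jcont[OF gc] by (auto simp: bcontfun_def bounded_iff intro!: continuous_intros)
    then show ?thesis by (simp add: T_def Bcontfun_inverse)
  qed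
  have "dist (T \<phi>) (T \<theta>) \<le> (1/2) * dist \<phi> \<theta>" for \<phi> \<theta>
  proof (rule dist_bound)
    fix t
    have "J (\<lambda>s. g (apply_bcontfun \<phi> s)) t - J (\<lambda>s. g (apply_bcontfun \<theta> s)) t
        = J (\<lambda>s. g (apply_bcontfun \<phi> s) - g (apply_bcontfun \<theta> s)) t"
      using integral_diff[OF int[OF gc[of \<phi>]] int[OF gc[of \<theta>]]] by (simp add: J_def)
    moreover have "norm (g (apply_bcontfun \<phi> s) - g (apply_bcontfun \<theta> s)) \<le> L * dist \<phi> \<theta>" for s
      using order_trans[OF glip mult_left_mono[OF dist_bounded L]] by (simp add: dist_norm)
    ultimately have "norm (J (\<lambda>s. g (apply_bcontfun \<phi> s)) t - J (\<lambda>s. g (apply_bcontfun \<theta> s)) t)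
        \<le> 3 * h * (L * dist \<phi> \<theta>)"
      using Jbound[OF continuous_on_diff[OF gc gc]] by metis
    also have "\<dots> \<le> (1/2) * dist \<phi> \<theta>"
      using mult_right_mono[OF hL, of "dist \<phi> \<theta>"] by (simp add: mult.assoc)
    finally show "dist (apply_bcontfun (T \<phi>) t) (apply_bcontfun (T \<theta>) t) \<le> (1/2) * dist \<phi> \<theta>"
      by (simp add: T dist_norm)
  qed
  then obtain \<phi> where fp: "T \<phi> = \<phi>"
    using banach_fix_type[of "1/2" T] by auto
  define f where "f = apply_bcontfun \<phi>"
  have f: "f t = z0 + J (\<lambda>s. g (f s)) t" for t
    using T[of \<phi> t] fp by (simp add: f_def)
  have gf: "continuous_on UNIV (\<lambda>s. g (f s))" using gc by (simp add: f_def)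
  show thesis
  proof (rule that[of h f])
    show "h > 0" by (rule h)
    show "f 0 = z0" using h f[of 0] by (simp add: J_def cl_def)
    fix t assume t: "t \<in> {-h<..<h}"
    have "norm (f t - z0) \<le> 3 * h * M" using Jbound[OF gf M, of t] f[of t] by simp
    then have ft: "f t \<in> cball z0 r" using hM by (simp add: dist_norm norm_minus_commute)
    have "((\<lambda>u. integral {-h..u} (\<lambda>s. g (f s))) has_vector_derivative g (f t)) (at t within {-h..h})"
      using t gf by (intro integral_has_vector_derivative) (auto intro: continuous_on_subset)
    then have "((\<lambda>u. z0 + (integral {-h..u} (\<lambda>s. g (f s)) - integral {-h..0} (\<lambda>s. g (f s))))
        has_vector_derivative g (f t)) (at t)"
      using t by (auto intro!: derivative_eq_intros simp: at_within_Icc_at)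
    then have "(f has_vector_derivative g (f t)) (at t)"
    proof (rule has_vector_derivative_transform_within_open)
      show "z0 + (integral {-h..u} (\<lambda>s. g (f s)) - integral {-h..0} (\<lambda>s. g (f s))) = f u"
        if "u \<in> {-h<..<h}" for u
      proof -
        have "cl u = u" using that by (auto simp: cl_def)
        then show ?thesis using f[of u] by (simp add: J_def)
      qed
    qed (use t in auto)
    then show "f t \<in> cball z0 r \<and> (f has_vector_derivative V (f t)) (at t)"
      using ft by (simp add: g_def closest_point_self)
  qed
qed

section \<open>Curves with acceleration parallel to velocity\<close>

text \<open>
Every functional that vanishes on the direction of the line is constant along the curve, so it annihilates
velocity and acceleration.
\<close>

lemma collinear_imp_velocity_parallel_acceleration:
  fixes c :: "real \<Rightarrow> 'a::real_inner"
  assumes "open I" "t0 \<in> I" "collinear (c ` I)"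
    and c: "\<And>t. t \<in> I \<Longrightarrow> (c has_vector_derivative c' t) (at t)"
    and c': "(c' has_vector_derivative a) (at t0)"
    and "c' t0 \<noteq> 0"
  shows "\<exists>P. a = P *\<^sub>R c' t0"
proof -
  obtain u where u: "\<And>x y. x \<in> c ` I \<Longrightarrow> y \<in> c ` I \<Longrightarrow> \<exists>k. x - y = k *\<^sub>R u"
    using assms(3) unfolding collinear_def by blast
  have v: "w \<bullet> c' t = 0" if wu: "w \<bullet> u = 0" and t: "t \<in> I" for w t
  proof -
    have "((\<lambda>s. w \<bullet> c s) has_vector_derivative w \<bullet> c' t) (at t)"
      using bounded_linear.has_vector_derivative[OF bounded_linear_inner_right c[OF t]] .
    moreover have "((\<lambda>s. w \<bullet> c s) has_vector_derivative 0) (at t)"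
    proof (rule has_vector_derivative_transform_within_open[OF has_vector_derivative_const assms(1) t])
      fix s assume "s \<in> I"
      then obtain k where "c s - c t = k *\<^sub>R u"
        using u[of "c s" "c t"] \<open>t \<in> I\<close> by auto
      then have "w \<bullet> (c s - c t) = w \<bullet> (k *\<^sub>R u)" by simp
      then show "w \<bullet> c t = w \<bullet> c s" using \<open>w \<bullet> u = 0\<close> by (simp add: inner_diff_right)
    qed
    ultimately show ?thesis using vector_derivative_unique_at by blast
  qed
  have a: "w \<bullet> a = 0" if "w \<bullet> u = 0" for w
  proof -
    have "((\<lambda>s. w \<bullet> c' s) has_vector_derivative w \<bullet> a) (at t0)"
      using bounded_linear.has_vector_derivative[OF bounded_linear_inner_right c'] .
    moreover have "((\<lambda>s. w \<bullet> c' s) has_vector_derivative 0) (at t0)"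
      by (rule has_vector_derivative_transform_within_open[OF has_vector_derivative_const assms(1,2)])
        (use v that in auto)
    ultimately show ?thesis using vector_derivative_unique_at by blast
  qed
  have par: "q = (q \<bullet> u / (u \<bullet> u)) *\<^sub>R u" if "\<And>w. w \<bullet> u = 0 \<Longrightarrow> w \<bullet> q = 0" for q
  proof -
    define w where "w = q - (q \<bullet> u / (u \<bullet> u)) *\<^sub>R u"
    have "w \<bullet> u = 0" by (cases "u = 0") (auto simp: w_def inner_diff_left)
    then have "w \<bullet> w = 0" using that[of w] by (simp add: w_def inner_diff_right inner_diff_left)
    then show ?thesis by (simp add: w_def)
  qed
  define \<nu> where "\<nu> = c' t0 \<bullet> u / (u \<bullet> u)"
  define \<mu> where "\<mu> = a \<bullet> u / (u \<bullet> u)"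
  have "c' t0 = \<nu> *\<^sub>R u" "a = \<mu> *\<^sub>R u"
    unfolding \<nu>_def \<mu>_def using par v assms(2) a by blast+
  then show ?thesis using \<open>c' t0 \<noteq> 0\<close> by (intro exI[of _ "\<mu> / \<nu>"]) auto
qed

lemma has_derivative_norm_compose:
  fixes g :: "'a::real_normed_vector \<Rightarrow> 'b::real_inner"
  assumes "(g has_derivative g') (at z)" "g z \<noteq> 0"
  shows "((\<lambda>z. norm (g z)) has_derivative (\<lambda>v. (g z \<bullet> g' v) / norm (g z))) (at z)"
  by (rule has_derivative_eq_rhs[OF has_derivative_compose[OF assms(1) has_derivative_norm[OF assms(2)]]])
    (simp add: sgn_div_norm divide_inverse inner_commute mult.commute)

text \<open>
The unit tangent \<open>c' / |c'|\<close> has derivative zero, because the acceleration has no component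
orthogonal to \<open>c'\<close>.
\<close>

lemma parallel_acceleration_imp_collinear:
  fixes c :: "real \<Rightarrow> 'a::euclidean_space"
  assumes "open I" "is_interval I"
    and c: "\<And>t. t \<in> I \<Longrightarrow> (c has_vector_derivative c' t) (at t)"
    and c': "\<And>t. t \<in> I \<Longrightarrow> (c' has_vector_derivative \<kappa> t *\<^sub>R c' t) (at t)"
    and nz: "\<And>t. t \<in> I \<Longrightarrow> c' t \<noteq> 0"
  shows "collinear (c ` I)"
proof (cases "I = {}")
  case False
  then obtain t0 where t0: "t0 \<in> I" by blast
  have conn: "connected I" "convex I" using assms(2) is_interval_connected is_interval_convex by auto
  have const: "p t = p t0" if "\<And>t. t \<in> I \<Longrightarrow> (p has_vector_derivative 0) (at t)" "t \<in> I"
    for p :: "real \<Rightarrow> 'a" and t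
    using has_derivative_zero_unique_connected[OF assms(1) conn(1), of p t t0] that t0
    by (simp add: has_vector_derivative_def)
  define d where "d t = inverse (norm (c' t)) *\<^sub>R c' t" for t
  have "(d has_vector_derivative 0) (at t)" if t: "t \<in> I" for t
  proof -
    have n: "((\<lambda>s. norm (c' s)) has_vector_derivative \<kappa> t * norm (c' t)) (at t)"
    proof -
      have "((\<lambda>s. norm (c' s)) has_derivative (\<lambda>h. c' t \<bullet> (h *\<^sub>R \<kappa> t *\<^sub>R c' t) / norm (c' t))) (at t)"
        by (rule has_derivative_norm_compose[OF c'[OF t, unfolded has_vector_derivative_def] nz[OF t]])
      then show ?thesis
        using nz[OF t] by (simp add: has_vector_derivative_def dot_square_norm power2_eq_square field_simps)
    qed
    then have r: "((\<lambda>s. norm (c' s)) has_real_derivative \<kappa> t * norm (c' t)) (at t)"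
      by (simp add: has_real_derivative_iff_has_vector_derivative)
    have "((\<lambda>s. inverse (norm (c' s))) has_real_derivative - \<kappa> t * inverse (norm (c' t))) (at t)"
      by (rule DERIV_cong[OF DERIV_inverse'[OF r]]) (use nz[OF t] in auto)
    from has_vector_derivative_scaleR[OF this c'[OF t]]
    show ?thesis unfolding d_def by (simp add: mult.commute)
  qed
  then have d: "d t = d t0" if "t \<in> I" for t using const that by blast
  define e where "e = d t0"
  have c'e: "c' t = norm (c' t) *\<^sub>R e" if "t \<in> I" for t
  proof -
    have "c' t = norm (c' t) *\<^sub>R d t" using nz[OF that] by (simp add: d_def)
    then show ?thesis using d[OF that] by (simp add: e_def)
  qed
  have ee: "e \<bullet> e = 1"
    using nz[OF t0] by (simp add: e_def d_def dot_square_norm power2_eq_square field_simps)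
  (* The component of the curve orthogonal to the constant unit tangent e does not move. *)
  have "((\<lambda>t. c t - (c t \<bullet> e) *\<^sub>R e) has_vector_derivative 0) (at t)" if "t \<in> I" for t
  proof -
    have "((\<lambda>t. c t \<bullet> e) has_vector_derivative c' t \<bullet> e) (at t)"
      using bounded_linear.has_vector_derivative[OF bounded_linear_inner_left c[OF that]] .
    then have "((\<lambda>t. (c t \<bullet> e) *\<^sub>R e) has_vector_derivative (c' t \<bullet> e) *\<^sub>R e) (at t)"
      using bounded_linear.has_vector_derivative[OF bounded_linear_scaleR_left] by blast
    moreover have "(c' t \<bullet> e) *\<^sub>R e = c' t"
      using c'e[OF that] ee by (metis inner_scaleR_left mult.right_neutral)
    ultimately show ?thesis
      using has_vector_derivative_diff[OF c[OF that]] by fastforce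
  qed
  then have "c t - (c t \<bullet> e) *\<^sub>R e = c t0 - (c t0 \<bullet> e) *\<^sub>R e" if "t \<in> I" for t
    using const[of "\<lambda>t. c t - (c t \<bullet> e) *\<^sub>R e"] that by blast
  then have "c s - (c s \<bullet> e) *\<^sub>R e = c t - (c t \<bullet> e) *\<^sub>R e" if "s \<in> I" "t \<in> I" for s t
    using that by simp
  then have "c s - c t = (c s \<bullet> e - c t \<bullet> e) *\<^sub>R e" if "s \<in> I" "t \<in> I" for s t
    using that by (simp add: algebra_simps)
  then show ?thesis unfolding collinear_def by blast
qed auto

section \<open>Coordinates\<close>

text \<open>
Contracting the coordinate derivatives with a vector gives the derivative along that vector. This turns the
index sums of the flatness equations into single directional derivatives.
\<close>

lemma linear_fst_axis_expansion:
  fixes \<phi> :: "(real^'n) \<times> 'b::real_normed_vector \<Rightarrow> real"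
  assumes "linear \<phi>"
  shows "(\<Sum>k\<in>UNIV. a $ k * \<phi> (axis k 1, 0)) = \<phi> (a, 0)"
proof -
  have l: "linear (\<lambda>a. \<phi> (a, 0))"
    using linear_add[OF assms, of "(_, 0)" "(_, 0)"] linear_cmul[OF assms, of _ "(_, 0)"]
    by (auto simp: linear_iff)
  have "\<phi> (a, 0) = \<phi> (\<Sum>k\<in>UNIV. a $ k *\<^sub>R axis k 1, 0)"
    using basis_expansion[of a] by (simp add: scalar_mult_eq_scaleR)
  also have "\<dots> = (\<Sum>k\<in>UNIV. a $ k * \<phi> (axis k 1, 0))"
    by (simp add: linear_sum[OF l] linear_cmul[OF l])
  finally show ?thesis ..
qed

lemma linear_snd_axis_expansion:
  fixes \<phi> :: "'b::real_normed_vector \<times> (real^'n) \<Rightarrow> real"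
  assumes "linear \<phi>"
  shows "(\<Sum>k\<in>UNIV. b $ k * \<phi> (0, axis k 1)) = \<phi> (0, b)"
proof -
  have l: "linear (\<lambda>b. \<phi> (0, b))"
    using linear_add[OF assms, of "(0, _)" "(0, _)"] linear_cmul[OF assms, of _ "(0, _)"]
    by (auto simp: linear_iff)
  have "\<phi> (0, b) = \<phi> (0, \<Sum>k\<in>UNIV. b $ k *\<^sub>R axis k 1)"
    using basis_expansion[of b] by (simp add: scalar_mult_eq_scaleR)
  also have "\<dots> = (\<Sum>k\<in>UNIV. b $ k * \<phi> (0, axis k 1))"
    by (simp add: linear_sum[OF l] linear_cmul[OF l])
  finally show ?thesis ..
qed

text \<open>
The identification needs agreement with a differentiable function only near the point, so it can be iterated
for second derivatives that exist only off the zero section.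
\<close>

lemma dx_eq_dir_deriv:
  assumes "open S" "(x, y) \<in> S" "\<And>a b. (a, b) \<in> S \<Longrightarrow> G a b = g (a, b)" "g differentiable (at (x, y))"
  shows "dx i G x y = dir_deriv g (axis i 1, 0) (x, y)"
proof -
  note c = dir_deriv_cong_open[OF assms(1,2) _ assms(4), of "\<lambda>z. G (fst z) (snd z)"]
  have "(\<lambda>z. G (fst z) (snd z)) differentiable (at ((x, y) + 0 *\<^sub>R (axis i 1, 0)))"
    using c(1) assms(3) by simp
  from DERIV_imp_deriv[OF has_real_derivative_along_line[OF this]] show ?thesis
    using c(2) assms(3) by (simp add: dx_def partial_def)
qed

lemma dy_eq_dir_deriv:
  assumes "open S" "(x, y) \<in> S" "\<And>a b. (a, b) \<in> S \<Longrightarrow> G a b = g (a, b)" "g differentiable (at (x, y))"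
  shows "dy i G x y = dir_deriv g (0, axis i 1) (x, y)"
proof -
  note c = dir_deriv_cong_open[OF assms(1,2) _ assms(4), of "\<lambda>z. G (fst z) (snd z)"]
  have "(\<lambda>z. G (fst z) (snd z)) differentiable (at ((x, y) + 0 *\<^sub>R (0, axis i 1)))"
    using c(1) assms(3) by simp
  from DERIV_imp_deriv[OF has_real_derivative_along_line[OF this]] show ?thesis
    using c(2) assms(3) by (simp add: dy_def partial_def)
qed

lemma matrix_inv_inverse:
  fixes A :: "real^'n^'n"
  assumes "invertible A"
  shows "matrix_inv A ** A = mat 1" "A ** matrix_inv A = mat 1"
  using someI_ex[OF assms[unfolded invertible_def]] by (auto simp: matrix_inv_def)

section \<open>Homogeneity and the fundamental tensor\<close>

locale finsler_space =
  fixes U :: "(real^'n) set" and F :: "real^'n \<Rightarrow> real^'n \<Rightarrow> real"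
  assumes openU: "open U" and finsler: "finsler_metric_on U F"
begin

text \<open>
The metric as one function of the pair, so that base and fibre derivatives are both directional derivatives
of it and their order can be exchanged.
\<close>

definition f :: "(real^'n) \<times> (real^'n) \<Rightarrow> real" where "f = (\<lambda>(x, y). F x y)"

definition \<Omega> :: "((real^'n) \<times> (real^'n)) set" where "\<Omega> = U \<times> (- {0})"

abbreviation L :: "(real^'n) \<times> (real^'n) \<Rightarrow> real" where "L \<equiv> \<lambda>z. f z * f z"

abbreviation X :: "real^'n \<Rightarrow> (real^'n) \<times> (real^'n) \<Rightarrow> real" where
  "X a \<equiv> dir_deriv f (a, 0)"

abbreviation Y :: "real^'n \<Rightarrow> (real^'n) \<times> (real^'n) \<Rightarrow> real" where
  "Y b \<equiv> dir_deriv f (0, b)"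

lemma f_pair [simp]: "f (x, y) = F x y"
  by (simp add: f_def)

lemma open_\<Omega>: "open \<Omega>"
  unfolding \<Omega>_def using openU by (intro open_Times) auto

lemma \<Omega>_iff: "(x, y) \<in> \<Omega> \<longleftrightarrow> x \<in> U \<and> y \<noteq> 0"
  by (simp add: \<Omega>_def)

lemma smooth_f: "smooth_on f \<Omega>"
  using finsler by (simp add: finsler_metric_on_def f_def \<Omega>_def)

lemma smooth_L: "smooth_on L \<Omega>"
  using open_\<Omega> smooth_f smooth_f by (rule smooth_on_mult)

lemmas smooth_diff = smooth_on_differentiable[OF smooth_f]
  smooth_on_differentiable[OF smooth_on_dir_deriv[OF smooth_f]]
  smooth_on_differentiable[OF smooth_on_dir_deriv[OF smooth_on_dir_deriv[OF smooth_f]]]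

lemmas commute = smooth_on_dir_deriv_commute[OF open_\<Omega> smooth_f]

lemma nonneg: "x \<in> U \<Longrightarrow> F x y \<ge> 0"
  using finsler by (simp add: finsler_metric_on_def)

lemma homogeneous: "x \<in> U \<Longrightarrow> c > 0 \<Longrightarrow> F x (c *\<^sub>R y) = c * F x y"
  using finsler by (simp add: finsler_metric_on_def)

text \<open>
All consequences of homogeneity come from differentiating along the ray \<open>t y\<close> at \<open>t = 1\<close>.
\<close>

lemma dir_deriv_fiber_radial:
  assumes "(x, y) \<in> \<Omega>" "p differentiable (at (x, y))"
    and "\<And>t. t > 0 \<Longrightarrow> p (x, t *\<^sub>R y) = q t" "(q has_real_derivative d) (at 1)"
  shows "dir_deriv p (0, y) (x, y) = (d :: real)"
proof -
  have "((\<lambda>t. p ((x, 0) + t *\<^sub>R (0, y))) has_real_derivative dir_deriv p (0, y) (x, y)) (at 1)"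
    using has_real_derivative_along_line[of p "(x, 0)" 1 "(0, y)"] assms(2) by simp
  moreover have "((\<lambda>t. p ((x, 0) + t *\<^sub>R (0, y))) has_real_derivative d) (at 1)"
    by (rule has_field_derivative_transform_within_open[OF assms(4), of "{0<..}"])
      (auto simp: assms(3))
  ultimately show ?thesis by (rule DERIV_unique)
qed

lemma euler: 
  assumes "(x, y) \<in> \<Omega>"
  shows "Y y (x, y) = F x y"
  using assms
  by (intro dir_deriv_fiber_radial[where q = "\<lambda>t. t * F x y"])
    (auto simp: homogeneous \<Omega>_iff smooth_diff intro!: derivative_eq_intros)

lemma Y_homogeneous:
  assumes "(x, y) \<in> \<Omega>" "c > 0"
  shows "Y b (x, c *\<^sub>R y) = Y b (x, y)"
proof -
  have cy: "(x, c *\<^sub>R y) \<in> \<Omega>" using assms by (simp add: \<Omega>_iff)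
  have "((\<lambda>t. f ((x, c *\<^sub>R y) + t *\<^sub>R (0, c *\<^sub>R b))) has_real_derivative Y (c *\<^sub>R b) (x, c *\<^sub>R y)) (at 0)"
    using has_real_derivative_along_line[of f "(x, c *\<^sub>R y)" 0 "(0, c *\<^sub>R b)"] smooth_diff(1)[OF cy] by simp
  moreover have "f ((x, c *\<^sub>R y) + t *\<^sub>R (0, c *\<^sub>R b)) = c * f ((x, y) + t *\<^sub>R (0, b))" for t
    using homogeneous[of x c "y + t *\<^sub>R b"] assms by (simp add: \<Omega>_iff scaleR_add_right mult.commute)
  moreover have "((\<lambda>t. c * f ((x, y) + t *\<^sub>R (0, b))) has_real_derivative c * Y b (x, y)) (at 0)"
    using has_real_derivative_along_line[of f "(x, y)" 0 "(0, b)"] smooth_diff(1)[OF assms(1)]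
    by (intro DERIV_cmult) simp
  ultimately have "Y (c *\<^sub>R b) (x, c *\<^sub>R y) = c * Y b (x, y)"
    using DERIV_unique by fastforce
  moreover have "Y (c *\<^sub>R b) (x, c *\<^sub>R y) = c * Y b (x, c *\<^sub>R y)"
    using dir_deriv_scaleR_right[OF smooth_diff(1)[OF cy], of c "(0, b)"] by simp
  ultimately show ?thesis using assms by simp
qed

lemma Y_radial_derivative_zero:
  assumes "(x, y) \<in> \<Omega>"
  shows "dir_deriv (Y b) (0, y) (x, y) = 0"
  using assms
  by (intro dir_deriv_fiber_radial[where q = "\<lambda>t. Y b (x, y)"]) (auto simp: Y_homogeneous smooth_diff)

lemma dir_deriv_L: "z \<in> \<Omega> \<Longrightarrow> dir_deriv L v z = 2 * f z * dir_deriv f v z"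
  by (simp add: dir_deriv_mult smooth_diff)

lemma dir_deriv2_L:
  assumes "z \<in> \<Omega>"
  shows "dir_deriv (dir_deriv L v) w z
    = 2 * (dir_deriv f w z * dir_deriv f v z + f z * dir_deriv (dir_deriv f v) w z)"
proof -
  have "dir_deriv (dir_deriv L v) w z = dir_deriv (\<lambda>z. (2 * f z) * dir_deriv f v z) w z"
    using smooth_on_differentiable[OF smooth_on_dir_deriv[OF smooth_L] assms]
    by (intro dir_deriv_cong_open(2)[OF open_\<Omega> assms, symmetric]) (auto simp: dir_deriv_L)
  moreover have "dir_deriv (\<lambda>z. 2 * f z) w z = 2 * dir_deriv f w z"
    using dir_deriv_mult[of "\<lambda>_. 2" z f w] smooth_diff(1)[OF assms] by simp
  ultimately show ?thesis
    using smooth_diff[OF assms] by (simp add: dir_deriv_mult)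
qed

lemma sq_eq_L: "sq F x y = L (x, y)"
  by (simp add: sq_def power2_eq_square)

lemma dx_sq: "(x, y) \<in> \<Omega> \<Longrightarrow> dx i (sq F) x y = dir_deriv L (axis i 1, 0) (x, y)"
  by (rule dx_eq_dir_deriv[OF open_\<Omega> _ sq_eq_L smooth_on_differentiable[OF smooth_L]])

lemma dy_sq: "(x, y) \<in> \<Omega> \<Longrightarrow> dy i (sq F) x y = dir_deriv L (0, axis i 1) (x, y)"
  by (rule dy_eq_dir_deriv[OF open_\<Omega> _ sq_eq_L smooth_on_differentiable[OF smooth_L]])

lemma dy_dx_sq: "(x, y) \<in> \<Omega> \<Longrightarrow>
    dy l (dx k (sq F)) x y = dir_deriv (dir_deriv L (axis k 1, 0)) (0, axis l 1) (x, y)"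
  by (rule dy_eq_dir_deriv[OF open_\<Omega> _ dx_sq smooth_on_differentiable[OF smooth_on_dir_deriv[OF smooth_L]]])

lemma dy_dy_sq: "(x, y) \<in> \<Omega> \<Longrightarrow>
    dy l (dy k (sq F)) x y = dir_deriv (dir_deriv L (0, axis k 1)) (0, axis l 1) (x, y)"
  by (rule dy_eq_dir_deriv[OF open_\<Omega> _ dy_sq smooth_on_differentiable[OF smooth_on_dir_deriv[OF smooth_L]]])

lemma contracted_mixed_derivative:
  assumes "(x, y) \<in> \<Omega>"
  shows "(\<Sum>k\<in>UNIV. dy l (dx k (sq F)) x y * y $ k)
    = 2 * (X y (x, y) * Y (axis l 1) (x, y) + F x y * dir_deriv (Y (axis l 1)) (y, 0) (x, y))"
proof -
  have "(\<Sum>k\<in>UNIV. dy l (dx k (sq F)) x y * y $ k)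
      = (\<Sum>k\<in>UNIV. y $ k * dir_deriv (dir_deriv L (0, axis l 1)) (axis k 1, 0) (x, y))"
    using smooth_on_dir_deriv_commute[OF open_\<Omega> smooth_L assms]
    by (intro sum.cong) (auto simp: dy_dx_sq[OF assms] mult.commute)
  also have "\<dots> = dir_deriv (dir_deriv L (0, axis l 1)) (y, 0) (x, y)"
    using smooth_on_differentiable[OF smooth_on_dir_deriv[OF smooth_L] assms]
    by (intro linear_fst_axis_expansion bounded_linear.linear[OF bounded_linear_dir_deriv])
  finally show ?thesis by (simp add: dir_deriv2_L[OF assms])
qed

text \<open>
Euler's relation for the fibre derivatives of \<open>F\<^sup>2\<close>, which are homogeneous of degree one: \<open>g y\<close> is half
the fibre gradient of \<open>F\<^sup>2\<close>.
\<close>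

lemma fund_tensor_mult_y:
  assumes "(x, y) \<in> \<Omega>"
  shows "fund_tensor F x y *v y = F x y *\<^sub>R (\<chi> i. Y (axis i 1) (x, y))"
proof -
  have "(fund_tensor F x y *v y) $ i = F x y * Y (axis i 1) (x, y)" for i
  proof -
    have "(fund_tensor F x y *v y) $ i
        = 1 / 2 * (\<Sum>j\<in>UNIV. y $ j * dir_deriv (dir_deriv L (0, axis i 1)) (0, axis j 1) (x, y))"
      by (simp add: matrix_vector_mult_def fund_tensor_def dy_dy_sq[OF assms] sum_distrib_left mult_ac)
    also have "(\<Sum>j\<in>UNIV. y $ j * dir_deriv (dir_deriv L (0, axis i 1)) (0, axis j 1) (x, y))
        = dir_deriv (dir_deriv L (0, axis i 1)) (0, y) (x, y)"
      using smooth_on_differentiable[OF smooth_on_dir_deriv[OF smooth_L] assms]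
      by (intro linear_snd_axis_expansion bounded_linear.linear[OF bounded_linear_dir_deriv])
    also have "\<dots> = 2 * (F x y * Y (axis i 1) (x, y))"
      by (simp add: dir_deriv2_L[OF assms] euler[OF assms] Y_radial_derivative_zero[OF assms])
    finally show ?thesis by simp
  qed
  then show ?thesis by (simp add: vec_eq_iff)
qed

lemma Y_expansion:
  assumes "(x, y) \<in> \<Omega>"
  shows "b \<bullet> (\<chi> i. Y (axis i 1) (x, y)) = Y b (x, y)"
  using linear_snd_axis_expansion[OF bounded_linear.linear[OF bounded_linear_dir_deriv[OF smooth_diff(1)[OF assms]]], of b]
  by (simp add: inner_vec_def)

lemma fund_tensor_pos_def:
  "(x, y) \<in> \<Omega> \<Longrightarrow> v \<noteq> 0 \<Longrightarrow> v \<bullet> (fund_tensor F x y *v v) > 0"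
  using finsler by (simp add: finsler_metric_on_def \<Omega>_iff)

text \<open>
Contracting the preceding identity with \<open>y\<close> gives \<open>g(y, y) = F\<^sup>2\<close>.
\<close>

lemma F_pos:
  assumes "(x, y) \<in> \<Omega>"
  shows "F x y > 0"
proof -
  have "y \<bullet> (fund_tensor F x y *v y) = F x y * F x y"
    by (simp add: fund_tensor_mult_y[OF assms] Y_expansion[OF assms] euler[OF assms])
  then have "F x y \<noteq> 0" using fund_tensor_pos_def[OF assms, of y] assms by (auto simp: \<Omega>_iff)
  then show ?thesis using nonneg assms by (simp add: \<Omega>_iff less_le)
qed

lemma invertible_fund_tensor:
  assumes "(x, y) \<in> \<Omega>"
  shows "invertible (fund_tensor F x y)"
proof -
  have "v = 0" if "fund_tensor F x y *v v = 0" for v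
    using fund_tensor_pos_def[OF assms, of v] that by auto
  then show ?thesis
    unfolding invertible_left_inverse using matrix_left_invertible_ker by blast
qed

text \<open>
The Euler--Lagrange expression of the energy, whose image under a quarter of the inverse fundamental tensor
is the spray.
\<close>

definition euler_covector :: "real^'n \<Rightarrow> real^'n \<Rightarrow> real^'n" where
  "euler_covector x y = (\<chi> l. (\<Sum>k\<in>UNIV. dy l (dx k (sq F)) x y * y $ k) - dx l (sq F) x y)"

lemma fund_tensor_mult_spray:
  assumes "(x, y) \<in> \<Omega>"
  shows "fund_tensor F x y *v spray F x y = (1/4) *\<^sub>R euler_covector x y"
  using matrix_inv_inverse(2)[OF invertible_fund_tensor[OF assms]]
  by (simp add: spray_def euler_covector_def matrix_vector_mult_scaleR matrix_vector_mul_assoc)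

lemma euler_covector_component:
  assumes "(x, y) \<in> \<Omega>"
  shows "euler_covector x y $ l = 2 * (X y (x, y) * Y (axis l 1) (x, y)
    + F x y * dir_deriv (Y (axis l 1)) (y, 0) (x, y)) - 2 * F x y * X (axis l 1) (x, y)"
  using contracted_mixed_derivative[OF assms]
  by (simp add: euler_covector_def dx_sq[OF assms] dir_deriv_L[OF assms])

text \<open>
Dual flatness in coordinate-free form. Schwarz's theorem puts the base derivative along the fixed vector \<open>y\<close>
outermost, which removes the sum; both sides are linear in \<open>b\<close>, so coordinate vectors suffice.
\<close>

lemma dually_flat_iff:
  "dually_flat_on U F \<longleftrightarrow> (\<forall>(x, y)\<in>\<Omega>. \<forall>b.
    X y (x, y) * Y b (x, y) + F x y * dir_deriv (Y b) (y, 0) (x, y) = 2 * F x y * X b (x, y))"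
  (is "_ \<longleftrightarrow> (\<forall>(x, y)\<in>\<Omega>. \<forall>b. ?P x y b)")
proof -
  have "(\<forall>l. (\<Sum>k\<in>UNIV. dy l (dx k (sq F)) x y * y $ k) - 2 * dx l (sq F) x y = 0) \<longleftrightarrow> (\<forall>b. ?P x y b)"
    if z: "(x, y) \<in> \<Omega>" for x y
  proof -
    have "(\<forall>l. (\<Sum>k\<in>UNIV. dy l (dx k (sq F)) x y * y $ k) - 2 * dx l (sq F) x y = 0)
        \<longleftrightarrow> (\<forall>l. ?P x y (axis l 1))"
    proof -
      have "(\<Sum>k\<in>UNIV. dy l (dx k (sq F)) x y * y $ k) - 2 * dx l (sq F) x y
          = 2 * (X y (x, y) * Y (axis l 1) (x, y) + F x y * dir_deriv (Y (axis l 1)) (y, 0) (x, y)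
            - 2 * F x y * X (axis l 1) (x, y))" for l
        unfolding contracted_mixed_derivative[OF z] dx_sq[OF z] dir_deriv_L[OF z] f_pair by (simp add: algebra_simps)
      then show ?thesis by (simp only: mult_eq_0_iff right_minus_eq) simp
    qed
    also have "\<dots> \<longleftrightarrow> (\<forall>b. ?P x y b)"
    proof (intro iffI allI)
      fix b assume *: "\<forall>l. ?P x y (axis l 1)"
      have e: "(\<Sum>k\<in>UNIV. b $ k * X (axis k 1) (x, y)) = X b (x, y)"
        "(\<Sum>k\<in>UNIV. b $ k * Y (axis k 1) (x, y)) = Y b (x, y)"
        using linear_fst_axis_expansion[of "\<lambda>v. dir_deriv f v (x, y)" b]
          linear_snd_axis_expansion[of "\<lambda>v. dir_deriv f v (x, y)" b]
          bounded_linear.linear[OF bounded_linear_dir_deriv[OF smooth_diff(1)[OF z]]] by simp_all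
      have "(\<Sum>k\<in>UNIV. b $ k * dir_deriv (dir_deriv f (y, 0)) (0, axis k 1) (x, y))
          = dir_deriv (dir_deriv f (y, 0)) (0, b) (x, y)"
        using smooth_diff(2)[OF z]
        by (intro linear_snd_axis_expansion bounded_linear.linear[OF bounded_linear_dir_deriv])
      then have e3: "(\<Sum>k\<in>UNIV. b $ k * dir_deriv (Y (axis k 1)) (y, 0) (x, y))
          = dir_deriv (Y b) (y, 0) (x, y)"
        by (simp add: commute[OF z, of "(y, 0)"])
      have "(\<Sum>k\<in>UNIV. b $ k * (X y (x, y) * Y (axis k 1) (x, y) + F x y * dir_deriv (Y (axis k 1)) (y, 0) (x, y)))
          = (\<Sum>k\<in>UNIV. b $ k * (2 * F x y * X (axis k 1) (x, y)))"
        using * by simp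
      then show "?P x y b"
        unfolding e[symmetric] e3[symmetric]
        by (simp add: sum_distrib_left sum.distrib algebra_simps)
    qed auto
    finally show ?thesis .
  qed
  then show ?thesis unfolding dually_flat_on_def \<Omega>_def by auto
qed

section \<open>The transport equation and its consequences\<close>

text \<open>
In coordinates \<open>F\<^bsub>x\<^sup>l\<^esub> = k F F\<^bsub>y\<^sup>l\<^esub>\<close>.
\<close>

definition transport_eq :: "real \<Rightarrow> (real^'n) set \<Rightarrow> bool" where
  "transport_eq k C \<longleftrightarrow> (\<forall>x\<in>C. \<forall>y. y \<noteq> 0 \<longrightarrow> (\<forall>a. X a (x, y) = k * F x y * Y a (x, y)))"

text \<open>
This is the classical equation \<open>F\<^bsub>x\<^sup>k y\<^sup>l\<^esub> y\<^sup>k = F\<^bsub>x\<^sup>l\<^esub>\<close> for straight geodesics. It comes from the fibre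
derivative of \<open>X y = k F (Y y)\<close> with \<open>y\<close> held fixed: the second fibre derivative vanishes by homogeneity.
\<close>

lemma transport_eq_mixed_derivative:
  assumes "open C" "C \<subseteq> U" "transport_eq k C" "x \<in> C" "y \<noteq> 0"
  shows "dir_deriv (Y b) (y, 0) (x, y) = X b (x, y)"
proof -
  have z: "(x, y) \<in> \<Omega>" using assms by (auto simp: \<Omega>_iff)
  have eq: "(k * f z) * Y y z = X y z" if "z \<in> C \<times> (-{0})" for z
    using assms(3) that by (cases z) (simp add: transport_eq_def)
  have d: "(\<lambda>z. k * f z) differentiable (at (x, y))"
    using smooth_diff(1)[OF z] by (intro derivative_intros)
  have "dir_deriv (Y b) (y, 0) (x, y) = dir_deriv (X y) (0, b) (x, y)"
    by (rule commute[OF z])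
  also have "\<dots> = dir_deriv (\<lambda>z. (k * f z) * Y y z) (0, b) (x, y)"
    using assms(1,4,5) eq d smooth_diff(2)[OF z]
    by (intro dir_deriv_cong_open(2)[where S = "C \<times> (-{0})"]) (auto intro!: open_Times derivative_intros)
  also have "\<dots> = k * F x y * dir_deriv (Y y) (0, b) (x, y) + k * Y b (x, y) * Y y (x, y)"
    using smooth_diff[OF z] d by (simp add: dir_deriv_mult)
  also have "dir_deriv (Y y) (0, b) (x, y) = 0"
    using commute[OF z] Y_radial_derivative_zero[OF z] by simp
  also have "k * F x y * 0 + k * Y b (x, y) * Y y (x, y) = X b (x, y)"
    using assms(3-5) by (simp add: euler[OF z] transport_eq_def)
  finally show ?thesis .
qed

text \<open>
The Euler--Lagrange covector becomes \<open>2 k F\<close> times \<open>g y\<close>, so inverting \<open>g\<close> is immediate.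
\<close>

lemma transport_eq_spray:
  assumes "open C" "C \<subseteq> U" "transport_eq k C" "x \<in> C" "y \<noteq> 0"
  shows "spray F x y = (k * F x y / 2) *\<^sub>R y"
proof -
  have z: "(x, y) \<in> \<Omega>" using assms by (auto simp: \<Omega>_iff)
  have "euler_covector x y = (2 * k * F x y) *\<^sub>R (fund_tensor F x y *v y)"
    using assms(3-5)
    by (simp add: vec_eq_iff euler_covector_component[OF z] transport_eq_mixed_derivative[OF assms]
        fund_tensor_mult_y[OF z] euler[OF z] transport_eq_def)
  then have "spray F x y = (1 / 4 * (2 * k * F x y)) *\<^sub>R (matrix_inv (fund_tensor F x y) *v (fund_tensor F x y *v y))"
    by (simp add: spray_def flip: euler_covector_def matrix_vector_mult_scaleR)
  then show ?thesis
    using matrix_inv_inverse(1)[OF invertible_fund_tensor[OF z]]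
    by (simp add: matrix_vector_mul_assoc)
qed

lemma component_subset: "C \<in> components U \<Longrightarrow> open C \<and> C \<subseteq> U"
  using open_components openU in_components_subset by blast

lemma transport_eq_imp_dually_flat:
  assumes "\<And>C. C \<in> components U \<Longrightarrow> \<exists>k. transport_eq k C"
  shows "dually_flat_on U F"
  unfolding dually_flat_iff
proof clarify
  fix x y b assume z: "(x, y) \<in> \<Omega>"
  then obtain C where C: "C \<in> components U" "x \<in> C"
    using Union_components[of U] unfolding \<Omega>_iff by blast
  then obtain k where k: "transport_eq k C" using assms by blast
  have "y \<noteq> 0" using z by (simp add: \<Omega>_iff)
  then show "X y (x, y) * Y b (x, y) + F x y * dir_deriv (Y b) (y, 0) (x, y) = 2 * F x y * X b (x, y)"
    using transport_eq_mixed_derivative[OF _ _ k C(2), of y b] component_subset[OF C(1)] k C(2)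
    by (simp add: euler[OF z] transport_eq_def)
qed

lemma transport_eq_imp_projectively_flat:
  assumes "\<And>C. C \<in> components U \<Longrightarrow> \<exists>k. transport_eq k C"
  shows "projectively_flat_on U F"
  unfolding projectively_flat_on_def
proof clarify
  fix I c assume I: "open I" "is_interval I" and "geodesic_on U F I c"
  then obtain c' c'' where g: "\<And>t. t \<in> I \<Longrightarrow> (c has_vector_derivative c' t) (at t)"
    "\<And>t. t \<in> I \<Longrightarrow> (c' has_vector_derivative c'' t) (at t)"
    "\<And>t. t \<in> I \<Longrightarrow> c t \<in> U" "\<And>t. t \<in> I \<Longrightarrow> c' t \<noteq> 0"
    "\<And>t. t \<in> I \<Longrightarrow> c'' t + 2 *\<^sub>R spray F (c t) (c' t) = 0"
    unfolding geodesic_on_def by blast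
  have "\<exists>\<kappa>. c'' t = \<kappa> *\<^sub>R c' t" if t: "t \<in> I" for t
  proof -
    obtain C where C: "C \<in> components U" "c t \<in> C"
      using Union_components[of U] g(3)[OF t] by blast
    then obtain k where "transport_eq k C" using assms by blast
    then have "c'' t = - (2 *\<^sub>R ((k * F (c t) (c' t) / 2) *\<^sub>R c' t))"
      using transport_eq_spray[OF _ _ _ C(2) g(4)[OF t]] component_subset[OF C(1)] g(5)[OF t]
      by (simp add: eq_neg_iff_add_eq_0)
    then show ?thesis by (metis scaleR_minus_left scaleR_scaleR)
  qed
  then obtain \<kappa> where "\<And>t. t \<in> I \<Longrightarrow> c'' t = \<kappa> t *\<^sub>R c' t" by metis
  then show "collinear (c ` I)"
    using g by (intro parallel_acceleration_imp_collinear[OF I, of c c' \<kappa>]) auto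
qed

section \<open>Consequences of flatness\<close>


text \<open>
By Cramer's rule the components of the spray are quotients of determinants of smooth functions.
\<close>

lemma spray_locally_lipschitz:
  assumes "cball z0 r \<subseteq> \<Omega>"
  shows "\<exists>B. B-lipschitz_on (cball z0 r) (\<lambda>(x, y). (y, - (2 *\<^sub>R spray F x y)))"
proof -
  define G where "G z = fund_tensor F (fst z) (snd z)" for z
  define E where "E z = euler_covector (fst z) (snd z)" for z
  define s where "s z = spray F (fst z) (snd z)" for z
  have L2: "times_cont_diff_on 1 (dir_deriv (dir_deriv L v) w) \<Omega>" for v w
    using smooth_on_dir_deriv[OF smooth_on_dir_deriv[OF smooth_L]] unfolding smooth_on_def by blast
  have L1: "times_cont_diff_on 1 (dir_deriv L v) \<Omega>" for v
    using smooth_on_dir_deriv[OF smooth_L] unfolding smooth_on_def by blast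
  have G: "times_cont_diff_on 1 (\<lambda>z. G z $ i $ j) \<Omega>" for i j
    by (rule times_cont_diff_on_cong_imp[OF open_\<Omega> _ times_cont_diff_on_mult[OF open_\<Omega>
          times_cont_diff_on_const[of _ "1/2"] L2]])
      (auto simp: G_def fund_tensor_def dy_dy_sq)
  have c: "times_cont_diff_on 1 (\<lambda>z. snd z $ k) \<Omega>" for k
    by (intro times_cont_diff_on_bounded_linear bounded_linear_compose[OF bounded_linear_vec_nth bounded_linear_snd])
  have E: "times_cont_diff_on 1 (\<lambda>z. E z $ l) \<Omega>" for l
    by (rule times_cont_diff_on_cong_imp[OF open_\<Omega> _ times_cont_diff_on_add[OF open_\<Omega>
          times_cont_diff_on_sum[OF open_\<Omega> times_cont_diff_on_mult[OF open_\<Omega> L2 c]]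
          times_cont_diff_on_mult[OF open_\<Omega> times_cont_diff_on_const[of _ "-1"] L1]]])
      (auto simp: E_def euler_covector_def dy_dx_sq dx_sq)
  have det_nz: "det (G z) \<noteq> 0" if "z \<in> \<Omega>" for z
    using invertible_fund_tensor[of "fst z" "snd z"] that by (simp add: G_def invertible_det_nz)
  have cr: "s z $ k = det (\<chi> i j. if j = k then ((1/4) *\<^sub>R E z) $ i else G z $ i $ j) * inverse (det (G z))"
    if "z \<in> \<Omega>" for z k
  proof -
    have "G z *v s z = (1/4) *\<^sub>R E z"
      using fund_tensor_mult_spray[of "fst z" "snd z"] that by (simp add: G_def s_def E_def)
    then have "s z = (\<chi> k. det (\<chi> i j. if j = k then ((1/4) *\<^sub>R E z) $ i else G z $ i $ j) / det (G z))"
      by (rule iffD1[OF cramer[OF det_nz[OF that]]])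
    then show ?thesis by (simp add: divide_inverse)
  qed
  have e4: "times_cont_diff_on 1 (\<lambda>z. ((1/4) *\<^sub>R E z) $ i) \<Omega>" for i
    using times_cont_diff_on_mult[OF open_\<Omega> times_cont_diff_on_const[of _ "1/4"] E] by simp
  have "times_cont_diff_on 1 (\<lambda>z. s z $ k) \<Omega>" for k
  proof (rule times_cont_diff_on_cong_imp[OF open_\<Omega> cr[symmetric]])
    show "times_cont_diff_on 1 (\<lambda>z. det (\<chi> i j. if j = k then ((1/4) *\<^sub>R E z) $ i else G z $ i $ j)
        * inverse (det (G z))) \<Omega>"
    proof (intro times_cont_diff_on_mult times_cont_diff_on_inverse times_cont_diff_on_det open_\<Omega> G det_nz)
      fix i j
      show "times_cont_diff_on 1 (\<lambda>z. (\<chi> i j. if j = k then ((1/4) *\<^sub>R E z) $ i else G z $ i $ j) $ i $ j) \<Omega>"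
        using e4 G by (cases "j = k") simp_all
    qed
  qed
  then have "\<forall>k. \<exists>B. B-lipschitz_on (cball z0 r) (\<lambda>z. s z $ k)"
    using times_cont_diff_on_1_imp_lipschitz_on_cball[OF _ assms] by blast
  from choice[OF this] obtain B
    where "\<forall>k. (B k)-lipschitz_on (cball z0 r) (\<lambda>z. s z $ k)" ..
  then have B: "(B k)-lipschitz_on (cball z0 r) (\<lambda>z. s z $ k)" for k ..
  have B0: "B k \<ge> 0" for k using B lipschitz_on_nonneg by blast
  define D where "D = 1 + 2 * (\<Sum>k\<in>UNIV. B k)"
  have "D-lipschitz_on (cball z0 r) (\<lambda>z. (snd z, - (2 *\<^sub>R s z)))"
  proof (rule lipschitz_onI)
    show "D \<ge> 0" by (simp add: D_def B0 sum_nonneg)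
    fix z w assume zw: "z \<in> cball z0 r" "w \<in> cball z0 r"
    have "dist (s z) (s w) \<le> (\<Sum>k\<in>UNIV. \<bar>(s z - s w) $ k\<bar>)"
      unfolding dist_norm by (rule norm_le_l1_cart)
    also have "\<dots> \<le> (\<Sum>k\<in>UNIV. B k * dist z w)"
      using lipschitz_onD[OF B zw] by (intro sum_mono) (simp add: dist_real_def)
    finally have 1: "dist (s z) (s w) \<le> (\<Sum>k\<in>UNIV. B k) * dist z w"
      by (simp add: sum_distrib_right)
    have "dist (snd z, - (2 *\<^sub>R s z)) (snd w, - (2 *\<^sub>R s w))
        \<le> dist (snd z) (snd w) + dist (- (2 *\<^sub>R s z)) (- (2 *\<^sub>R s w))"
      unfolding dist_Pair_Pair by (rule sqrt_sum_squares_le_sum) auto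
    also have "dist (- (2 *\<^sub>R s z)) (- (2 *\<^sub>R s w)) = 2 * dist (s z) (s w)"
      by (simp add: dist_norm norm_minus_commute flip: scaleR_diff_right)
    also have "dist (snd z) (snd w) + 2 * dist (s z) (s w)
        \<le> dist z w + 2 * ((\<Sum>k\<in>UNIV. B k) * dist z w)"
      using 1 dist_snd_le[of z w] by linarith
    finally show "dist (snd z, - (2 *\<^sub>R s z)) (snd w, - (2 *\<^sub>R s w)) \<le> D * dist z w"
      by (simp add: D_def algebra_simps)
  qed
  then show ?thesis by (auto simp: s_def case_prod_unfold)
qed

lemma geodesic_exists:
  assumes "(x, y) \<in> \<Omega>"
  obtains h c c' where "h > 0" "geodesic_on U F {-h<..<h} c"
    "\<And>t. t \<in> {-h<..<h} \<Longrightarrow> (c has_vector_derivative c' t) (at t)"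
    "(c' has_vector_derivative - (2 *\<^sub>R spray F x y)) (at 0)" "c' 0 = y"
proof -
  define V where "V = (\<lambda>(x, y). (y, - (2 *\<^sub>R spray F x y)))"
  obtain r where r: "r > 0" "cball (x, y) r \<subseteq> \<Omega>"
    using open_contains_cball[of \<Omega>] open_\<Omega> assms by blast
  obtain B where B: "B-lipschitz_on (cball (x, y) r) V"
    using spray_locally_lipschitz[OF r(2)] unfolding V_def by blast
  obtain h \<phi> where \<phi>: "h > 0" "\<phi> 0 = (x, y)"
    "\<And>t. t \<in> {-h<..<h} \<Longrightarrow> \<phi> t \<in> cball (x, y) r \<and> (\<phi> has_vector_derivative V (\<phi> t)) (at t)"
    using picard_lindelof[OF r(1) B] by blast
  have in\<Omega>: "(fst (\<phi> t), snd (\<phi> t)) \<in> \<Omega>" if "t \<in> {-h<..<h}" for t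
    using \<phi>(3)[OF that] r(2) by auto
  have c: "((\<lambda>t. fst (\<phi> t)) has_vector_derivative snd (\<phi> t)) (at t)"
    "((\<lambda>t. snd (\<phi> t)) has_vector_derivative - (2 *\<^sub>R spray F (fst (\<phi> t)) (snd (\<phi> t)))) (at t)"
    if "t \<in> {-h<..<h}" for t
    using bounded_linear.has_vector_derivative[OF bounded_linear_fst conjunct2[OF \<phi>(3)[OF that]]]
      bounded_linear.has_vector_derivative[OF bounded_linear_snd conjunct2[OF \<phi>(3)[OF that]]]
    by (simp_all add: V_def case_prod_unfold)
  show thesis
  proof (rule that[of h "\<lambda>t. fst (\<phi> t)" "\<lambda>t. snd (\<phi> t)"])
    show "h > 0" by (rule \<phi>)
    show "geodesic_on U F {-h<..<h} (\<lambda>t. fst (\<phi> t))"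
      unfolding geodesic_on_def
    proof (intro exI ballI)
      fix t assume t: "t \<in> {-h<..<h}"
      show "((\<lambda>t. fst (\<phi> t)) has_vector_derivative snd (\<phi> t)) (at t) \<and>
        ((\<lambda>t. snd (\<phi> t)) has_vector_derivative - (2 *\<^sub>R spray F (fst (\<phi> t)) (snd (\<phi> t)))) (at t) \<and>
        fst (\<phi> t) \<in> U \<and> snd (\<phi> t) \<noteq> 0 \<and>
        - (2 *\<^sub>R spray F (fst (\<phi> t)) (snd (\<phi> t))) + 2 *\<^sub>R spray F (fst (\<phi> t)) (snd (\<phi> t)) = 0"
        using in\<Omega>[OF t] unfolding \<Omega>_iff by (intro conjI c[OF t]) (auto simp only: ab_left_minus)
    qed
    show "((\<lambda>t. snd (\<phi> t)) has_vector_derivative - (2 *\<^sub>R spray F x y)) (at 0)"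
      using c(2)[of 0] \<phi>(1,2) by simp
    show "((\<lambda>t. fst (\<phi> t)) has_vector_derivative snd (\<phi> t)) (at t)" if "t \<in> {-h<..<h}" for t
      by (rule c(1)[OF that])
    show "snd (\<phi> 0) = y" by (simp add: \<phi>(2))
  qed
qed

lemma projectively_flat_imp_spray_parallel:
  assumes "projectively_flat_on U F" "(x, y) \<in> \<Omega>"
  shows "\<exists>P. spray F x y = P *\<^sub>R y"
proof -
  obtain h c c' where g: "h > 0" "geodesic_on U F {-h<..<h} c"
    "\<And>t. t \<in> {-h<..<h} \<Longrightarrow> (c has_vector_derivative c' t) (at t)"
    "(c' has_vector_derivative - (2 *\<^sub>R spray F x y)) (at 0)" "c' 0 = y"
    using geodesic_exists[OF assms(2)] by blast
  have "open {-h<..<h}" "is_interval {-h<..<h}"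
    by (simp_all add: is_interval_oo)
  then have col: "collinear (c ` {-h<..<h})"
    using assms(1) g(2) unfolding projectively_flat_on_def by blast
  have "\<exists>P. - (2 *\<^sub>R spray F x y) = P *\<^sub>R c' 0"
    by (rule collinear_imp_velocity_parallel_acceleration[OF \<open>open {-h<..<h}\<close> _ col g(3,4)])
      (use g(1,5) assms(2) in \<open>simp_all add: \<Omega>_iff\<close>)
  then obtain P where "- (2 *\<^sub>R spray F x y) = P *\<^sub>R y"
    unfolding g(5) by blast
  then have "(- 1 / 2) *\<^sub>R (- (2 *\<^sub>R spray F x y)) = (- 1 / 2) *\<^sub>R (P *\<^sub>R y)"
    by simp
  then have "spray F x y = (- 1 / 2 * P) *\<^sub>R y"
    by simp
  then show ?thesis by blast
qed

text \<open>
The factor \<open>X y / F\<^sup>2\<close>. Since the direction \<open>y\<close> varies with the point, the coordinate sum is the form in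
which differentiability is evident.
\<close>

definition \<kappa> :: "(real^'n) \<times> (real^'n) \<Rightarrow> real" where
  "\<kappa> z = (\<Sum>k\<in>UNIV. snd z $ k * X (axis k 1) z) / (f z * f z)"

lemma \<kappa>_eq: "(x, y) \<in> \<Omega> \<Longrightarrow> \<kappa> (x, y) = X y (x, y) / (F x y * F x y)"
  using linear_fst_axis_expansion[of "\<lambda>v. dir_deriv f v (x, y)" y]
    bounded_linear.linear[OF bounded_linear_dir_deriv[OF smooth_diff(1)]]
  by (simp add: \<kappa>_def)

lemma \<kappa>_differentiable:
  assumes "z \<in> \<Omega>"
  shows "\<kappa> differentiable (at z)"
proof -
  have "f z \<noteq> 0" using F_pos[of "fst z" "snd z"] assms by (simp add: f_def case_prod_unfold)
  moreover have "(\<lambda>z. snd z $ k) differentiable (at z)" for k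
    by (intro bounded_linear_imp_differentiable bounded_linear_compose[OF bounded_linear_vec_nth bounded_linear_snd])
  ultimately show ?thesis
    unfolding \<kappa>_def[abs_def] using smooth_diff[OF assms]
    by (intro derivative_intros differentiable_sum) auto
qed

text \<open>
Let the spray be \<open>P y\<close>. Then the Euler--Lagrange covector is \<open>4 P (g y)\<close>, that is, \<open>4 P F\<close> times the fibre gradient of \<open>F\<close>,
while dual flatness makes it \<open>2 F\<close> times the base gradient. Hence \<open>X a = 2 P (Y a)\<close>, and \<open>a = y\<close>
determines \<open>P\<close>.
\<close>

lemma flat_imp_transport:
  assumes "projectively_flat_on U F" "dually_flat_on U F" "(x, y) \<in> \<Omega>"
  shows "X a (x, y) = \<kappa> (x, y) * F x y * Y a (x, y)"
proof -
  note z = assms(3)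
  obtain P where P: "spray F x y = P *\<^sub>R y"
    using projectively_flat_imp_spray_parallel[OF assms(1,3)] by blast
  define N where "N = (\<chi> l. X (axis l 1) (x, y))"
  define M where "M = (\<chi> l. Y (axis l 1) (x, y))"
  have "X y (x, y) * Y b (x, y) + F x y * dir_deriv (Y b) (y, 0) (x, y) = 2 * F x y * X b (x, y)" for b
    using assms(2) z unfolding dually_flat_iff by blast
  then have "euler_covector x y $ l = 2 * F x y * X (axis l 1) (x, y)" for l
    unfolding euler_covector_component[OF z] by simp
  then have "(2 * F x y) *\<^sub>R N = euler_covector x y"
    by (simp add: vec_eq_iff N_def)
  also have "\<dots> = 4 *\<^sub>R (fund_tensor F x y *v (P *\<^sub>R y))"
    using fund_tensor_mult_spray[OF z] by (simp add: P)
  finally have "(2 * F x y) *\<^sub>R N = (2 * F x y) *\<^sub>R ((2 * P) *\<^sub>R M)"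
    by (simp add: matrix_vector_mult_scaleR fund_tensor_mult_y[OF z] M_def mult_ac)
  then have N: "N = (2 * P) *\<^sub>R M"
    unfolding scaleR_cancel_left using F_pos[OF z] by simp
  have XY: "X a (x, y) = 2 * P * Y a (x, y)" for a
  proof -
    have "X a (x, y) = a \<bullet> N"
      using linear_fst_axis_expansion[of "\<lambda>v. dir_deriv f v (x, y)" a]
        bounded_linear.linear[OF bounded_linear_dir_deriv[OF smooth_diff(1)[OF z]]]
      by (simp add: N_def inner_vec_def)
    then show ?thesis using Y_expansion[OF z, of a] by (simp add: N M_def)
  qed
  have "\<kappa> (x, y) = 2 * P / F x y"
    using F_pos[OF z] XY[of y] by (simp add: \<kappa>_eq[OF z] euler[OF z])
  then show ?thesis
    using F_pos[OF z] XY[of a] by simp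
qed

text \<open>
Dual flatness gives \<open>D\<^bsub>(y, 0)\<^esub> (Y b) = X b\<close>. The fibre derivative of \<open>X y = \<kappa> F (Y y)\<close> with \<open>y\<close> held
fixed gives \<open>X b\<close> plus \<open>F\<^sup>2\<close> times the fibre derivative of \<open>\<kappa>\<close>.
\<close>

lemma flat_imp_\<kappa>_fiber_derivative_zero:
  assumes "projectively_flat_on U F" "dually_flat_on U F" "(x, y) \<in> \<Omega>"
  shows "dir_deriv \<kappa> (0, b) (x, y) = 0"
proof -
  note z = assms(3)
  have tr: "\<kappa> z * (f z * Y a z) = X a z" if "z \<in> \<Omega>" for a z
    using flat_imp_transport[OF assms(1,2), of "fst z" "snd z" a] that
    by (simp add: f_def case_prod_unfold mult.assoc)
  have "X y (x, y) * Y b (x, y) + F x y * dir_deriv (Y b) (y, 0) (x, y) = 2 * F x y * X b (x, y)"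
    using assms(2) z unfolding dually_flat_iff by blast
  moreover have "X y (x, y) * Y b (x, y) = F x y * X b (x, y)"
    by (simp add: euler[OF z] flip: tr[OF z])
  ultimately have "F x y * dir_deriv (Y b) (y, 0) (x, y) = F x y * X b (x, y)"
    by linarith
  then have "X b (x, y) = dir_deriv (X y) (0, b) (x, y)"
    using F_pos[OF z] commute[OF z] by simp
  also have "\<dots> = dir_deriv (\<lambda>z. \<kappa> z * (f z * Y y z)) (0, b) (x, y)"
    using smooth_diff(2)[OF z] by (intro dir_deriv_cong_open(2)[OF open_\<Omega> z, symmetric]) (auto simp: tr)
  also have "\<dots> = \<kappa> (x, y) * (F x y * dir_deriv (Y y) (0, b) (x, y) + Y b (x, y) * Y y (x, y))
      + dir_deriv \<kappa> (0, b) (x, y) * (F x y * Y y (x, y))"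
    using smooth_diff[OF z] \<kappa>_differentiable[OF z] by (simp add: dir_deriv_mult differentiable_mult)
  also have "dir_deriv (Y y) (0, b) (x, y) = 0"
    using commute[OF z] Y_radial_derivative_zero[OF z] by simp
  finally show ?thesis
    using tr[OF z, of b] F_pos[OF z] by (simp add: euler[OF z])
qed

text \<open>
In \<open>D\<^bsub>(c, 0)\<^esub> (X a)\<close>, with \<open>X a = \<kappa> F (Y a)\<close>, every term other than the one with the derivative of \<open>\<kappa>\<close> is
symmetric in \<open>a\<close> and \<open>c\<close>, and so is the whole by Schwarz's theorem.
\<close>

lemma flat_imp_\<kappa>_base_derivative_symmetric:
  assumes "projectively_flat_on U F" "dually_flat_on U F" "(x, y) \<in> \<Omega>"
  shows "dir_deriv \<kappa> (c, 0) (x, y) * Y a (x, y) = dir_deriv \<kappa> (a, 0) (x, y) * Y c (x, y)"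
proof -
  note z = assms(3)
  have tr: "\<kappa> z * (f z * Y a z) = X a z" if "z \<in> \<Omega>" for a z
    using flat_imp_transport[OF assms(1,2), of "fst z" "snd z" a] that
    by (simp add: f_def case_prod_unfold mult.assoc)
  have D: "dir_deriv (X a) v (x, y) = \<kappa> (x, y) * (F x y * dir_deriv (Y a) v (x, y)
      + dir_deriv f v (x, y) * Y a (x, y)) + dir_deriv \<kappa> v (x, y) * (F x y * Y a (x, y))" for a v
  proof -
    have "dir_deriv (X a) v (x, y) = dir_deriv (\<lambda>z. \<kappa> z * (f z * Y a z)) v (x, y)"
      using smooth_diff(2)[OF z] by (intro dir_deriv_cong_open(2)[OF open_\<Omega> z, symmetric]) (auto simp: tr)
    then show ?thesis
      using smooth_diff[OF z] \<kappa>_differentiable[OF z] by (simp add: dir_deriv_mult differentiable_mult)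
  qed
  have V: "dir_deriv (X c) (0, a) (x, y)
      = \<kappa> (x, y) * (F x y * dir_deriv (Y c) (0, a) (x, y) + Y a (x, y) * Y c (x, y))" for a c
    using D[of c "(0, a)"] flat_imp_\<kappa>_fiber_derivative_zero[OF assms] by simp
  have YX: "dir_deriv (Y a) (c, 0) (x, y)
      = \<kappa> (x, y) * (F x y * dir_deriv (Y c) (0, a) (x, y) + Y a (x, y) * Y c (x, y))" for a c
    using V commute[OF z, of "(0, a)" "(c, 0)"] by simp
  have "dir_deriv (X a) (c, 0) (x, y) = dir_deriv (X c) (a, 0) (x, y)"
    by (rule commute[OF z])
  moreover have "dir_deriv (Y c) (0, a) (x, y) = dir_deriv (Y a) (0, c) (x, y)"
    by (rule commute[OF z])
  moreover have "X a (x, y) * Y c (x, y) = X c (x, y) * Y a (x, y)"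
    by (simp flip: tr[OF z])
  ultimately have "dir_deriv \<kappa> (c, 0) (x, y) * (F x y * Y a (x, y))
      = dir_deriv \<kappa> (a, 0) (x, y) * (F x y * Y c (x, y))"
    by (simp add: D[of a "(c, 0)"] D[of c "(a, 0)"] YX algebra_simps)
  then show ?thesis using F_pos[OF z] by (simp add: mult.left_commute)
qed

text \<open>
The punctured fibre is connected in dimension at least two.
\<close>

lemma flat_imp_\<kappa>_indep_fiber:
  assumes "CARD('n) \<ge> 2" "projectively_flat_on U F" "dually_flat_on U F"
    and "x \<in> U" "y \<noteq> 0" "y' \<noteq> 0"
  shows "\<kappa> (x, y) = \<kappa> (x, y')"
proof (rule has_derivative_zero_unique_connected[of "- {0}" "\<lambda>y. \<kappa> (x, y)"])
  show "connected (- {0 :: real^'n})"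
    using assms(1) by (intro connected_punctured_universe) simp
  fix w :: "real^'n" assume "w \<in> - {0}"
  then have z: "(x, w) \<in> \<Omega>" using assms by (simp add: \<Omega>_iff)
  have "((\<lambda>y. (x, y)) has_derivative (\<lambda>b. (0, b))) (at w)"
    by (auto intro!: derivative_eq_intros)
  from has_derivative_compose[OF this has_derivative_dir_deriv[OF \<kappa>_differentiable[OF z]]]
  show "((\<lambda>y. \<kappa> (x, y)) has_derivative (\<lambda>b. 0)) (at w)"
    by (simp add: flat_imp_\<kappa>_fiber_derivative_zero[OF assms(2,3) z])
qed (use assms in auto)

text \<open>
The base derivative \<open>d\<close> of \<open>\<kappa>\<close> is the same at all points of a fibre, so the symmetry relation may be used at a
fibre point \<open>y'\<close> in the kernel of \<open>d\<close>, where it says \<open>d(c) F = d(y') (Y c) = 0\<close>.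
\<close>

lemma flat_imp_\<kappa>_base_derivative_zero:
  assumes "CARD('n) \<ge> 2" "projectively_flat_on U F" "dually_flat_on U F" "(x, y) \<in> \<Omega>"
  shows "dir_deriv \<kappa> (c, 0) (x, y) = 0"
proof -
  have lin: "linear (\<lambda>v. dir_deriv \<kappa> v (x, y))"
    using bounded_linear.linear[OF bounded_linear_dir_deriv[OF \<kappa>_differentiable[OF assms(4)]]] .
  define d where "d c = dir_deriv \<kappa> (c, 0) (x, y)" for c
  have d_add: "d (p *\<^sub>R v + q *\<^sub>R w) = p * d v + q * d w" for p q v w
    using linear_add[OF lin, of "(p *\<^sub>R v, 0)" "(q *\<^sub>R w, 0)"] linear_cmul[OF lin, of p "(v, 0)"]
      linear_cmul[OF lin, of q "(w, 0)"] by (simp add: d_def)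
  obtain i j :: 'n where "i \<noteq> j"
    using assms(1) card_le_Suc0_iff_eq[of "UNIV :: 'n set"] by auto
  obtain y' where y': "y' \<noteq> 0" "d y' = 0"
  proof (cases "d (axis i 1) = 0")
    case False
    (* A combination of two coordinate vectors that the linear functional d annihilates. *)
    define y' where "y' = d (axis j 1) *\<^sub>R axis i 1 + (- d (axis i 1)) *\<^sub>R (axis j 1 :: real^'n)"
    have "y' $ j \<noteq> 0" using False \<open>i \<noteq> j\<close> by (simp add: y'_def axis_def)
    then have "y' \<noteq> 0" by auto
    moreover have "d y' = 0" unfolding y'_def by (simp only: d_add) simp
    ultimately show thesis using that by blast
  qed (use that[of "axis i 1"] in \<open>simp add: axis_eq_0_iff\<close>)
  have z': "(x, y') \<in> \<Omega>" using assms(4) y' by (simp add: \<Omega>_iff)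
  have same: "dir_deriv \<kappa> (a, 0) (x, y') = d a" for a
  proof -
    have D: "((\<lambda>t. \<kappa> (x + t *\<^sub>R a, w)) has_real_derivative dir_deriv \<kappa> (a, 0) (x, w)) (at 0)"
      if "(x, w) \<in> \<Omega>" for w
      using has_real_derivative_along_line[of \<kappa> "(x, w)" 0 "(a, 0)"] \<kappa>_differentiable[OF that] by simp
    have "open ((\<lambda>t. x + t *\<^sub>R a) -` U)"
      using openU by (intro open_vimage continuous_intros)
    moreover have "0 \<in> (\<lambda>t. x + t *\<^sub>R a) -` U"
      using assms(4) by (simp add: \<Omega>_iff)
    moreover have "\<kappa> (x + t *\<^sub>R a, y) = \<kappa> (x + t *\<^sub>R a, y')"
      if "t \<in> (\<lambda>t. x + t *\<^sub>R a) -` U" for t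
      using flat_imp_\<kappa>_indep_fiber[OF assms(1-3) _ _ y'(1), of "x + t *\<^sub>R a" y] that assms(4)
      by (simp add: \<Omega>_iff)
    ultimately have "((\<lambda>t. \<kappa> (x + t *\<^sub>R a, y')) has_real_derivative d a) (at 0)"
      unfolding d_def by (rule has_field_derivative_transform_within_open[OF D[OF assms(4)]])
    then show ?thesis using D[OF z'] DERIV_unique by blast
  qed
  have "d c * F x y' = 0"
    using flat_imp_\<kappa>_base_derivative_symmetric[OF assms(2,3) z', of c y'] y'(2)
    by (simp add: same euler[OF z'])
  then show ?thesis using F_pos[OF z'] by (simp add: d_def)
qed

theorem flat_iff_transport_eq:
  assumes "CARD('n) \<ge> 2"
  shows "projectively_flat_on U F \<and> dually_flat_on U F \<longleftrightarrow>
    (\<forall>C\<in>components U. \<exists>k. transport_eq k C)"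
proof (intro iffI ballI)
  assume *: "projectively_flat_on U F \<and> dually_flat_on U F"
  fix C assume C: "C \<in> components U"
  have sub: "C \<times> (-{0}) \<subseteq> \<Omega>" using component_subset[OF C] by (auto simp: \<Omega>_iff)
  have "\<exists>k. \<forall>z\<in>C \<times> (-{0}). \<kappa> z = k"
  proof -
    have "\<kappa> z = \<kappa> z'" if "z \<in> C \<times> (-{0})" "z' \<in> C \<times> (-{0})" for z z'
    proof (rule has_derivative_zero_unique_connected[OF _ _ _ that])
      show "open (C \<times> (- {0 :: real^'n}))"
        using component_subset[OF C] by (intro open_Times) auto
      show "connected (C \<times> (- {0 :: real^'n}))"
        using assms in_components_connected[OF C]
        by (intro connected_Times connected_punctured_universe) simp_all
      fix w assume "w \<in> C \<times> (- {0 :: real^'n})"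
      then have w: "(fst w, snd w) \<in> \<Omega>" using sub by auto
      have "dir_deriv \<kappa> (a, b) (fst w, snd w) = 0" for a b
        using dir_deriv_add_right[OF \<kappa>_differentiable[OF w], of "(a, 0)" "(0, b)"]
          flat_imp_\<kappa>_base_derivative_zero[OF assms _ _ w] flat_imp_\<kappa>_fiber_derivative_zero[OF _ _ w] *
        by simp
      then have "(\<lambda>v. dir_deriv \<kappa> v w) = (\<lambda>v. 0)" by auto
      then show "(\<kappa> has_derivative (\<lambda>v. 0)) (at w)"
        using has_derivative_dir_deriv[OF \<kappa>_differentiable[OF w]] by simp
    qed
    then show ?thesis by blast
  qed
  then obtain k where k: "\<forall>z\<in>C \<times> (-{0}). \<kappa> z = k" ..
  have "transport_eq k C"
    unfolding transport_eq_def
  proof (intro ballI allI impI)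
    fix x y a :: "real^'n" assume "x \<in> C" "y \<noteq> 0"
    then have z: "(x, y) \<in> C \<times> (-{0})" by simp
    then show "X a (x, y) = k * F x y * Y a (x, y)"
      using flat_imp_transport[of x y a] * sub bspec[OF k z] by auto
  qed
  then show "\<exists>k. transport_eq k C" by blast
qed (use transport_eq_imp_dually_flat transport_eq_imp_projectively_flat in blast)

end

section \<open>Spherically symmetric metrics\<close>

lemma isCont_eventually_zero:
  fixes g :: "real \<Rightarrow> real"
  assumes "isCont g 0" "eventually (\<lambda>t. g t = 0) (at 0)"
  shows "g 0 = 0"
  using tendsto_unique[OF _ isContD[OF assms(1)] tendsto_eventually[OF assms(2)]] by simp

lemma exists_not_multiple:
  fixes y :: "real^'n"
  assumes "CARD('n) \<ge> 2"
  shows "\<exists>b. \<forall>c. b \<noteq> c *\<^sub>R y"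
proof -
  obtain i j :: 'n where ij: "i \<noteq> j"
    using assms card_le_Suc0_iff_eq[of "UNIV :: 'n set"] by auto
  show ?thesis
  proof (cases "y $ i = 0")
    case True
    have "axis i 1 \<noteq> c *\<^sub>R y" for c
    proof
      assume "axis i 1 = c *\<^sub>R y"
      then have "axis i 1 $ i = (c *\<^sub>R y) $ i" by simp
      then show False using True by simp
    qed
    then show ?thesis by blast
  next
    case False
    have "axis j 1 \<noteq> c *\<^sub>R y" for c
    proof
      assume eq: "axis j 1 = c *\<^sub>R y"
      then have "axis j 1 $ i = (c *\<^sub>R y) $ i" by simp
      then have "c = 0" using False ij by (simp add: axis_def)
      then show False using eq by (simp add: axis_eq_0_iff)
    qed
    then show ?thesis by blast
  qed
qed

text \<open>
A line whose direction is not a multiple of \<open>y\<close> meets the line spanned by \<open>y\<close> in at most one point.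
\<close>

lemma line_eventually_not_multiple:
  fixes x y b :: "'a::real_vector"
  assumes "\<forall>c. b \<noteq> c *\<^sub>R y"
  shows "eventually (\<lambda>t. \<forall>c. x + t *\<^sub>R b \<noteq> c *\<^sub>R y) (at (0::real))"
proof (cases "\<exists>t0 c0. x + t0 *\<^sub>R b = c0 *\<^sub>R y")
  case True
  then obtain t0 c0 where t0: "x + t0 *\<^sub>R b = c0 *\<^sub>R y" by blast
  have "t = t0" if "x + t *\<^sub>R b = c *\<^sub>R y" for t c
  proof (rule ccontr)
    assume "t \<noteq> t0"
    have "(t - t0) *\<^sub>R b = (x + t *\<^sub>R b) - (x + t0 *\<^sub>R b)"
      by (simp add: algebra_simps)
    also have "\<dots> = (c - c0) *\<^sub>R y"
      unfolding t0 that by (simp add: algebra_simps)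
    finally have "(1 / (t - t0)) *\<^sub>R ((t - t0) *\<^sub>R b) = (1 / (t - t0)) *\<^sub>R ((c - c0) *\<^sub>R y)"
      by simp
    then have "b = ((c - c0) / (t - t0)) *\<^sub>R y" using \<open>t \<noteq> t0\<close> by simp
    then show False using assms by blast
  qed
  then have "\<forall>c. x + t *\<^sub>R b \<noteq> c *\<^sub>R y" if "t \<noteq> t0" for t
    using that by blast
  then show ?thesis
    using eventually_neq_at_within[of t0 0 UNIV] by (rule eventually_mono[rotated])
qed auto

locale spherical_finsler_space = finsler_space U F
  for U :: "(real^'n) set" and F :: "real^'n \<Rightarrow> real^'n \<Rightarrow> real" +
  fixes \<psi> :: "real \<Rightarrow> real \<Rightarrow> real" and W :: "(real \<times> real) set"
  assumes open_W: "open W" and rs_domain_W: "rs_domain U \<subseteq> W"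
    and smooth_\<psi>: "smooth_on (\<lambda>(r, s). \<psi> r s) W"
    and F_eq: "\<And>x y. x \<in> U \<Longrightarrow> y \<noteq> 0 \<Longrightarrow> F x y = norm y * \<psi> (norm x) ((x \<bullet> y) / norm y)"
begin

text \<open>
The profile on pairs, to which the directional derivatives apply.
\<close>

definition p :: "real \<times> real \<Rightarrow> real" where "p = (\<lambda>(r, s). \<psi> r s)"

abbreviation p\<^sub>r :: "real \<times> real \<Rightarrow> real" where "p\<^sub>r \<equiv> dir_deriv p (1, 0)"

abbreviation p\<^sub>s :: "real \<times> real \<Rightarrow> real" where "p\<^sub>s \<equiv> dir_deriv p (0, 1)"

definition rs :: "(real^'n) \<times> (real^'n) \<Rightarrow> real \<times> real" where
  "rs = (\<lambda>(x, y). (norm x, (x \<bullet> y) / norm y))"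

lemma rs_in_W: "(x, y) \<in> \<Omega> \<Longrightarrow> rs (x, y) \<in> W"
  using rs_domain_W by (auto simp: rs_def rs_domain_def \<Omega>_iff)

lemma smooth_p: "smooth_on p W"
  using smooth_\<psi> by (simp add: p_def)

lemma p_differentiable: "w \<in> W \<Longrightarrow> p differentiable (at w)"
  "w \<in> W \<Longrightarrow> dir_deriv p v differentiable (at w)"
  using smooth_on_differentiable[OF smooth_p] smooth_on_differentiable[OF smooth_on_dir_deriv[OF smooth_p]]
  by auto

lemma dir_deriv_p: 
  assumes "w \<in> W"
  shows "dir_deriv p (\<alpha>, \<beta>) w = \<alpha> * p\<^sub>r w + \<beta> * p\<^sub>s w"
  using dir_deriv_add_right[OF p_differentiable(1)[OF assms], of "\<alpha> *\<^sub>R (1, 0)" "\<beta> *\<^sub>R (0, 1)"]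
    dir_deriv_scaleR_right[OF p_differentiable(1)[OF assms], of \<alpha> "(1, 0)"]
    dir_deriv_scaleR_right[OF p_differentiable(1)[OF assms], of \<beta> "(0, 1)"]
  by simp

lemma deriv_profile:
  assumes "(r, s) \<in> W"
  shows "deriv (\<lambda>\<rho>. \<psi> \<rho> s) r = p\<^sub>r (r, s)" "deriv (\<lambda>\<sigma>. \<psi> r \<sigma>) s = p\<^sub>s (r, s)"
  using DERIV_imp_deriv[OF has_real_derivative_along_line[of p "(0, s)" r "(1, 0)"]]
    DERIV_imp_deriv[OF has_real_derivative_along_line[of p "(r, 0)" s "(0, 1)"]] p_differentiable(1)[OF assms]
  by (simp_all add: p_def)

lemma f_eq: "(x, y) \<in> \<Omega> \<Longrightarrow> f (x, y) = norm y * p (rs (x, y))"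
  by (simp add: F_eq \<Omega>_iff p_def rs_def)

lemma rs_has_derivative:
  assumes "x \<noteq> 0" "y \<noteq> 0"
  shows "(rs has_derivative (\<lambda>(a, b). ((x \<bullet> a) / norm x,
    (a \<bullet> y + x \<bullet> b) / norm y - (x \<bullet> y) * (y \<bullet> b) / norm y ^ 3))) (at (x, y))"
proof -
  have n: "((\<lambda>z. norm (fst z)) has_derivative (\<lambda>v. (x \<bullet> fst v) / norm x)) (at (x, y))"
    "((\<lambda>z. norm (snd z)) has_derivative (\<lambda>v. (y \<bullet> snd v) / norm y)) (at (x, y))"
    using has_derivative_norm_compose[OF has_derivative_fst[OF has_derivative_ident], of "(x, y)"]
      has_derivative_norm_compose[OF has_derivative_snd[OF has_derivative_ident], of "(x, y)"] assms
    by simp_all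
  have i: "((\<lambda>z. fst z \<bullet> snd z) has_derivative (\<lambda>v. x \<bullet> snd v + fst v \<bullet> y)) (at (x, y))"
    by (auto intro!: derivative_eq_intros)
  have "((\<lambda>z. (fst z \<bullet> snd z) / norm (snd z)) has_derivative
      (\<lambda>v. (fst v \<bullet> y + x \<bullet> snd v) / norm y - (x \<bullet> y) * (y \<bullet> snd v) / norm y ^ 3)) (at (x, y))"
    by (rule has_derivative_eq_rhs[OF has_derivative_divide'[OF i n(2)]])
      (use assms in \<open>auto simp: fun_eq_iff field_simps power3_eq_cube\<close>)
  from has_derivative_Pair[OF n(1) this] show ?thesis
    unfolding rs_def by (simp add: case_prod_unfold)
qed

lemma spherical_dir_deriv:
  assumes "(x, y) \<in> \<Omega>" "x \<noteq> 0"
  shows "dir_deriv f (a, b) (x, y) = norm y * ((x \<bullet> a) / norm x * p\<^sub>r (rs (x, y)) +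
      ((a \<bullet> y + x \<bullet> b) / norm y - (x \<bullet> y) * (y \<bullet> b) / norm y ^ 3) * p\<^sub>s (rs (x, y)))
    + (y \<bullet> b) / norm y * p (rs (x, y))"
proof -
  have y: "y \<noteq> 0" using assms by (simp add: \<Omega>_iff)
  have n: "((\<lambda>z. norm (snd z)) has_derivative (\<lambda>v. (y \<bullet> snd v) / norm y)) (at (x, y))"
    using has_derivative_norm_compose[OF has_derivative_snd[OF has_derivative_ident], of "(x, y)"] y
    by simp
  define q where "q = (\<lambda>(a, b). ((x \<bullet> a) / norm x,
    (a \<bullet> y + x \<bullet> b) / norm y - (x \<bullet> y) * (y \<bullet> b) / norm y ^ 3))"
  have "((\<lambda>z. p (rs z)) has_derivative (\<lambda>v. dir_deriv p (q v) (rs (x, y)))) (at (x, y))"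
    unfolding q_def
    by (rule has_derivative_compose[OF rs_has_derivative[OF assms(2) y]
          has_derivative_dir_deriv[OF p_differentiable(1)[OF rs_in_W[OF assms(1)]]]])
  from has_derivative_mult[OF n this]
  have d: "((\<lambda>z. norm (snd z) * p (rs z)) has_derivative
      (\<lambda>v. norm y * dir_deriv p (q v) (rs (x, y)) + (y \<bullet> snd v) / norm y * p (rs (x, y)))) (at (x, y))"
    by simp
  have "norm (snd z) * p (rs z) = f z" if "z \<in> \<Omega>" for z
    using f_eq[of "fst z" "snd z"] that by simp
  with has_derivative_transform_within_open[OF d open_\<Omega> assms(1)]
  have "(f has_derivative
      (\<lambda>v. norm y * dir_deriv p (q v) (rs (x, y)) + (y \<bullet> snd v) / norm y * p (rs (x, y)))) (at (x, y))"
    by blast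
  from dir_deriv_eqI[OF this, of "(a, b)"] show ?thesis
    using dir_deriv_p[OF rs_in_W[OF assms(1)], of "fst (q (a, b))" "snd (q (a, b))"]
    by (simp add: q_def)
qed

text \<open>
The coefficients of \<open>x\<close> and \<open>y\<close> are the defects of the two profile equations.
\<close>

lemma transport_defect:
  assumes "(x, y) \<in> \<Omega>" "x \<noteq> 0"
  shows "X a (x, y) - k * F x y * Y a (x, y) =
    a \<bullet> ((norm y * (p\<^sub>r (rs (x, y)) / norm x - k * p (rs (x, y)) * p\<^sub>s (rs (x, y)))) *\<^sub>R x
      + (p\<^sub>s (rs (x, y)) - k * ((p (rs (x, y)))\<^sup>2 - snd (rs (x, y)) * p (rs (x, y)) * p\<^sub>s (rs (x, y)))) *\<^sub>R y)"
proof -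
  have y: "norm y \<noteq> 0" using assms by (simp add: \<Omega>_iff)
  have s: "x \<bullet> y = snd (rs (x, y)) * norm y" using y by (simp add: rs_def)
  have F: "F x y = norm y * p (rs (x, y))" using f_eq[OF assms(1)] by simp
  show ?thesis
    unfolding spherical_dir_deriv[OF assms] F s inner_add_right inner_scaleR_right inner_commute[of a]
      inner_zero_right inner_zero_left
    using y assms(2) by (simp add: field_simps power2_eq_square power3_eq_cube)
qed

lemma profile_equations_iff:
  assumes "(x, y) \<in> \<Omega>"
  shows "profile_equations k \<psi> (norm x) ((x \<bullet> y) / norm y) \<longleftrightarrow>
    (x \<noteq> 0 \<longrightarrow> p\<^sub>r (rs (x, y)) / norm x - k * p (rs (x, y)) * p\<^sub>s (rs (x, y)) = 0) \<and>
    p\<^sub>s (rs (x, y)) - k * ((p (rs (x, y)))\<^sup>2 - snd (rs (x, y)) * p (rs (x, y)) * p\<^sub>s (rs (x, y))) = 0"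
  using rs_in_W[OF assms] by (auto simp: profile_equations_def Let_def deriv_profile rs_def p_def)

text \<open>
Away from the origin the transport defect vanishes with both its coefficients. At the origin \<open>|x|\<close> is not
differentiable and the chain rule fails, but \<open>F\<close> is smooth there, so the equation extends by continuity.
\<close>

lemma profile_imp_transport_eq:
  assumes "open C" "C \<subseteq> U" and prof: "\<forall>(r, s)\<in>rs_domain C. profile_equations k \<psi> r s"
  shows "transport_eq k C"
  unfolding transport_eq_def
proof (intro ballI allI impI)
  fix x y a :: "real^'n" assume xC: "x \<in> C" and y: "y \<noteq> 0"
  have nz: "X a (x', y) - k * f (x', y) * Y a (x', y) = 0" if "x' \<in> C" "x' \<noteq> 0" for x'
  proof -
    have z: "(x', y) \<in> \<Omega>" using that(1) assms(2) y by (auto simp: \<Omega>_iff)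
    have "profile_equations k \<psi> (norm x') ((x' \<bullet> y) / norm y)"
      using prof that(1) y by (auto simp: rs_domain_def)
    then show ?thesis
      using transport_defect[OF z that(2), of a k] that(2) by (simp add: profile_equations_iff[OF z])
  qed
  have "X a (x, y) - k * f (x, y) * Y a (x, y) = 0"
  proof (cases "x = 0")
    case True
    define g where "g t = X a (x + t *\<^sub>R y, y) - k * f (x + t *\<^sub>R y, y) * Y a (x + t *\<^sub>R y, y)" for t :: real
    have z: "(x, y) \<in> \<Omega>" using xC assms(2) y by (auto simp: \<Omega>_iff)
    have c: "isCont (\<lambda>t::real. q (x + t *\<^sub>R y, y)) 0" if "q differentiable (at (x, y))"
      for q :: "(real^'n) \<times> (real^'n) \<Rightarrow> real"
      using differentiable_imp_continuous_within[OF that]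
      by (intro continuous_at_compose[of 0 "\<lambda>t. (x + t *\<^sub>R y, y)" q, unfolded o_def] continuous_intros) simp
    have "isCont g 0"
      unfolding g_def[abs_def] by (intro continuous_intros c smooth_diff z)
    moreover have "eventually (\<lambda>t. g t = 0) (at 0)"
    proof -
      have "open ((\<lambda>t::real. x + t *\<^sub>R y) -` C)"
        using assms(1) by (intro open_vimage continuous_intros)
      then have "eventually (\<lambda>t. t \<in> (\<lambda>t. x + t *\<^sub>R y) -` C) (at (0::real))"
        using xC by (intro eventually_at_in_open') auto
      moreover have "eventually (\<lambda>t. t \<noteq> 0) (at (0::real))"
        by (rule eventually_neq_at_within)
      ultimately show ?thesis
        by eventually_elim (use nz True y in \<open>auto simp: g_def simp del: f_pair\<close>)
    qed
    ultimately have "g 0 = 0" by (rule isCont_eventually_zero)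
    then show ?thesis by (simp add: g_def)
  qed (use nz xC in blast)
  then show "X a (x, y) = k * F x y * Y a (x, y)" by simp
qed

text \<open>
If \<open>x\<close> and \<open>y\<close> are independent, both coefficients of the transport defect vanish. Every other pair is a
limit of independent pairs \<open>(x + t b, y)\<close>, and the defects of the profile equations, with the first
multiplied by \<open>r\<close>, are continuous along this path.
\<close>

lemma transport_eq_imp_profile:
  assumes "CARD('n) \<ge> 2" "open C" "C \<subseteq> U" "transport_eq k C"
  shows "\<forall>(r, s)\<in>rs_domain C. profile_equations k \<psi> r s"
proof -
  (* The first defect is multiplied by r to remain continuous at r = 0. *)
  define A where "A w = p\<^sub>r w - k * fst w * p w * p\<^sub>s w" for w
  define B where "B w = p\<^sub>s w - k * ((p w)\<^sup>2 - snd w * p w * p\<^sub>s w)" for w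
  have indep: "A (rs (x, y)) = 0 \<and> B (rs (x, y)) = 0"
    if "x \<in> C" "y \<noteq> 0" "\<forall>c. x \<noteq> c *\<^sub>R y" for x y
  proof -
    have z: "(x, y) \<in> \<Omega>" using that assms(3) by (auto simp: \<Omega>_iff)
    have x: "x \<noteq> 0" using that(3)[rule_format, of 0] by simp
    define \<alpha> where "\<alpha> = norm y * (p\<^sub>r (rs (x, y)) / norm x - k * p (rs (x, y)) * p\<^sub>s (rs (x, y)))"
    have "a \<bullet> (\<alpha> *\<^sub>R x + B (rs (x, y)) *\<^sub>R y) = 0" for a
      using transport_defect[OF z x, of a k] assms(4) that(1,2)
      by (simp add: transport_eq_def B_def \<alpha>_def)
    then have v: "\<alpha> *\<^sub>R x + B (rs (x, y)) *\<^sub>R y = 0" using inner_eq_zero_iff by blast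
    have "\<alpha> = 0"
    proof (rule ccontr)
      assume "\<alpha> \<noteq> 0"
      have "\<alpha> *\<^sub>R x = (- B (rs (x, y))) *\<^sub>R y" using v by (simp add: eq_neg_iff_add_eq_0)
      then have "(1 / \<alpha>) *\<^sub>R (\<alpha> *\<^sub>R x) = (1 / \<alpha>) *\<^sub>R ((- B (rs (x, y))) *\<^sub>R y)" by simp
      then have "x = (- B (rs (x, y)) / \<alpha>) *\<^sub>R y" using \<open>\<alpha> \<noteq> 0\<close> by simp
      then show False using that(3) by blast
    qed
    then have "A (rs (x, y)) = 0"
      using x that(2) by (simp add: \<alpha>_def A_def rs_def field_simps)
    then show ?thesis using v \<open>\<alpha> = 0\<close> that(2) by simp
  qed
  have all: "A (rs (x, y)) = 0 \<and> B (rs (x, y)) = 0" if xC: "x \<in> C" and y: "y \<noteq> 0" for x y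
  proof -
    have z: "(x, y) \<in> \<Omega>" using that assms(3) by (auto simp: \<Omega>_iff)
    obtain b where b: "\<forall>c. b \<noteq> c *\<^sub>R y" using exists_not_multiple[OF assms(1), of y] by blast
    have rs: "isCont (\<lambda>t::real. rs (x + t *\<^sub>R b, y)) 0"
      unfolding rs_def using y by (auto intro!: continuous_intros)
    have "isCont q (rs (x, y))" if "q differentiable (at (rs (x, y)))" for q :: "real \<times> real \<Rightarrow> real"
      using differentiable_imp_continuous_within[OF that] .
    note pc = this[OF p_differentiable(1)[OF rs_in_W[OF z]]]
      this[OF p_differentiable(2)[OF rs_in_W[OF z]]]
    have "isCont A (rs (x, y))" "isCont B (rs (x, y))"
      unfolding A_def[abs_def] B_def[abs_def] by (intro continuous_intros pc)+
    then have AB: "isCont (\<lambda>t::real. A (rs (x + t *\<^sub>R b, y))) 0" "isCont (\<lambda>t::real. B (rs (x + t *\<^sub>R b, y))) 0"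
      using continuous_at_compose[OF rs, of A] continuous_at_compose[OF rs, of B] by (simp_all add: o_def)
    have "open ((\<lambda>t::real. x + t *\<^sub>R b) -` C)"
      using assms(2) by (intro open_vimage continuous_intros)
    then have "eventually (\<lambda>t. t \<in> (\<lambda>t. x + t *\<^sub>R b) -` C) (at (0::real))"
      using xC by (intro eventually_at_in_open') auto
    with line_eventually_not_multiple[OF b, of x]
    have ev: "eventually (\<lambda>t. A (rs (x + t *\<^sub>R b, y)) = 0 \<and> B (rs (x + t *\<^sub>R b, y)) = 0) (at 0)"
      by eventually_elim (use indep y in auto)
    show ?thesis
      using isCont_eventually_zero[OF AB(1)] isCont_eventually_zero[OF AB(2)] ev
      by (simp add: eventually_conj_iff)
  qed
  have "profile_equations k \<psi> (norm x) ((x \<bullet> y) / norm y)" if "x \<in> C" "y \<noteq> 0" for x y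
  proof -
    have z: "(x, y) \<in> \<Omega>" using that assms(3) by (auto simp: \<Omega>_iff)
    show ?thesis
      unfolding profile_equations_iff[OF z]
      using all[OF that] by (auto simp: A_def B_def rs_def field_simps)
  qed
  then show ?thesis by (auto simp: rs_domain_def)
qed

end

theorem theorem4p1:
  fixes U :: "(real^'n) set"
    and F :: "real^'n \<Rightarrow> real^'n \<Rightarrow> real"
    and \<psi> :: "real \<Rightarrow> real \<Rightarrow> real"
  assumes "CARD('n) \<ge> 2"
    and "open U"
    and "finsler_metric_on U F"
    and "spherically_symmetric_on U F"
    and "positive_smooth_profile (rs_domain U) \<psi>"
    and "\<And>x y. x \<in> U \<Longrightarrow> y \<noteq> 0 \<Longrightarrow> F x y = norm y * \<psi> (norm x) ((x \<bullet> y) / norm y)"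
  shows "projectively_flat_on U F \<and> dually_flat_on U F \<longleftrightarrow>
    (\<forall>C\<in>components U. \<exists>k\<^sub>1::real. \<forall>(r, s)\<in>rs_domain C. profile_equations k\<^sub>1 \<psi> r s)"
proof -
  obtain W where "open W" "rs_domain U \<subseteq> W" "smooth_on (\<lambda>(r, s). \<psi> r s) W"
    using assms(5) by (auto simp: positive_smooth_profile_def)
  then interpret spherical_finsler_space U F \<psi> W
    using assms(2,3,6) by unfold_locales
  have "transport_eq k C \<longleftrightarrow> (\<forall>(r, s)\<in>rs_domain C. profile_equations k \<psi> r s)"
    if "C \<in> components U" for C k
    using profile_imp_transport_eq transport_eq_imp_profile[OF assms(1)] component_subset[OF that] by blast
  then show ?thesis
    unfolding flat_iff_transport_eq[OF assms(1)] by simp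
qed

end
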